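(* With the notation of the context, assume $\|e_0-\overline\Phi_p*\overline\Phi_{p,\mathrm{inv}}\|_{1,\tau}<1$ and $\|e_0-\overline\Phi_p^2*\overline\Phi_{p,\mathrm{inv}}^2\|_{1,\tau}<1$. Define $$Z_{\infty,1}:=\|V_{p,1}^N-\mathscr V_{p,1}\|_{1,\tau}+\frac{\|\overline\Psi_{p,1}*\overline\Phi_{p,\mathrm{inv}}^2*(e_0-\overline\Phi_p^2*\overline\Phi_{p,\mathrm{inv}}^2)\|_{1,\tau}}{1-\|e_0-\overline\Phi_p^2*\overline\Phi_{p,\mathrm{inv}}^2\|_{1,\tau}},$$ $$Z_{\infty,2}:=\|V_{p,2}^N-\mathscr V_{p,2}\|_{1,\tau}+\frac{\|\overline\Psi_{p,2}*\overline\Phi_{p,\mathrm{inv}}*(e_0-\overline\Phi_p*\overline\Phi_{p,\mathrm{inv}})\|_{1,\tau}}{1-\|e_0-\overline\Phi_p*\overline\Phi_{p,\mathrm{inv}}\|_{1,\tau}},$$ $$Z_\infty:=\big(\|A_p^N\|_{\mathcal B(\ell^1_{e,\tau})}+\mathcal L_\infty\big)(Z_{\infty,1}+Z_{\infty,2}),$$ $$Z_1:=\left\|\boldsymbol\Pi^{\le N}\big(I-A_p(L_p+DG_p^N(\overline{\mathbf U}))\big)\boldsymbol\Pi^{\le 2N}\right\|_{\mathcal B(\ell^1_{e,\tau})}+2\mathcal L_\infty\big(\|V_{p,1}^N\|_{1,\tau}+\|V_{p,2}^N\|_{1,\tau}\big)+Z_\infty.$$ Then $\|I-A_pDF_p(\overline{\mathbf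 U})\|_{\mathcal B(\ell^1_{e,\tau})}\le Z_1$.
   Context: Parameters: $\nu,\nu_1,\dots,\nu_5>0$, $\nu_2>1/4$, $\tau\ge1$, $1\le d<\infty$, $\tilde n=n/(2d)$. Sequence spaces. $\mathbb N_0=\{0,1,2,\dots\}$, $\alpha_0=1$, $\alpha_n=2$ for $n\ge1$. $\ell^1_\tau(\mathbb N_0)$ is the Banach space of sequences with $\|U\|_{1,\tau}=\sum_{n\in\mathbb N_0}\alpha_n|u_n|\tau^n<\infty$; it is a Banach algebra under the even convolution $(U*V)_n=\sum_{k\in\mathbb Z}u_{|n-k|}v_{|k|}$, with unit $e_0=(1,0,0,\dots)$. $U^2=U*U$, $U^{-1}$ is the convolution inverse and $U^{-2}=U^{-1}*U^{-1}$. Scalars added to sequences mean multiples of $e_0$. $\ell^1_{e,\tau}=\ell^1_\tau(\mathbb N_0)^2$ with $\|\mathbf U\|_{1,\tau}=\|U_1\|_{1,\tau}+\|U_2\|_{1,\tau}$, and $\|\cdot\|_{\mathcal B(\ell^1_{e,\tau})}$ is the operator norm. $\Pi^{\le M}$ keeps the entries with index $n\le M$ and sets the others to $0$; $\Pi^{>M}=I-\Pi^{\le M}$; $\boldsymbol\Pi^{\le M},\boldsymbol\Pi^{>M}$ act componentwise on pairs. Zero-finding problem (cosine-series form of the stationary 1D Thomas system on $(-d,d)$). $F_p(\mathbf U)=L_p\mathbf U+G_p(\mathbf U)$, where $L_p$ acts modewise by $(L_p\mathbf U)_n=\begin{bmatrix}-(\nu(2\pi\tilde n)^2+1)&0\\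 \nu_3\nu-1&-((2\pi\tilde n)^2+\nu_3)\end{bmatrix}\mathbf U_n$ and $G_p(\mathbf U)=\begin{bmatrix}\nu_4-(\nu_1\nu U_1^2-\nu_1U_1*U_2)*(1+U_1+\nu_2U_1^2)^{-1}\\-\nu_3\nu_5+\nu_4\end{bmatrix}$. Data. $N,N_0\in\mathbb N$; $\overline{\mathbf U}=(\overline U_1,\overline U_2)$ is a fixed real sequence pair with $\overline{\mathbf U}=\boldsymbol\Pi^{\le N_0}\overline{\mathbf U}$ (a numerical approximate zero). $\overline\Phi_p=1+\overline U_1+\nu_2\overline U_1^2$; $\overline\Psi_{p,1}=-\nu_1(-\overline U_2+2\nu\overline U_1+\nu\overline U_1^2+\nu_2\overline U_1^2*\overline U_2)$; $\overline\Psi_{p,2}=\nu_1\overline U_1$. $\overline\Phi_{p,\mathrm{inv}}=\Pi^{\le 2N_0}\overline\Phi_{p,\mathrm{inv}}$ is a fixed real sequence (a numerical approximation of $\overline\Phi_p^{-1}$). $V_{p,1}=\overline\Psi_{p,1}*\overline\Phi_p^{-2}$, $V_{p,2}=\overline\Psi_{p,2}*\overline\Phi_p^{-1}$, $\mathscr V_{p,1}=\overline\Psi_{p,1}*\overline\Phi_{p,\mathrm{inv}}^2$, $\mathscr V_{p,2}=\overline\Psi_{p,2}*\overline\Phi_{p,\mathrm{inv}}$, $V_{p,j}^N=\Pi^{\le N}\mathscr V_{p,j}$. Denoting by $\mathbb V_{p,j}$, $\mathbb V_{p,j}^N$ the operators of convolution by $V_{p,j}$, $V_{p,j}^N$, set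 $DG_p(\overline{\mathbf U})=\begin{bmatrix}\mathbb V_{p,1}&\mathbb V_{p,2}\\0&0\end{bmatrix}$, $DG_p^N(\overline{\mathbf U})=\begin{bmatrix}\mathbb V_{p,1}^N&\mathbb V_{p,2}^N\\0&0\end{bmatrix}$, and $DF_p(\overline{\mathbf U})=L_p+DG_p(\overline{\mathbf U})$. Approximate inverse. $A_p^N=\boldsymbol\Pi^{\le N}A_p^N\boldsymbol\Pi^{\le N}$ is a fixed finite matrix (a numerical approximate inverse of $\boldsymbol\Pi^{\le N}DF_p(\overline{\mathbf U})\boldsymbol\Pi^{\le N}$). $A_p$ is defined by $(A_p\mathbf H)_n=(A_p^N\boldsymbol\Pi^{\le N}\mathbf H)_n$ for $n\le N$, and, for $n>N$, $(A_p\mathbf H)_n=(L_p^{-1}\mathbf H)_n$, i.e. $(A_p\mathbf H)_n=-\begin{bmatrix}\frac{(H_1)_n}{\nu(2\pi\tilde n)^2+1}\\ \frac{(\nu_3\nu-1)(H_1)_n}{(\nu(2\pi\tilde n)^2+1)((2\pi\tilde n)^2+\nu_3)}+\frac{(H_2)_n}{(2\pi\tilde n)^2+\nu_3}\end{bmatrix}$. Finally, $\mathcal L_\infty=\max_{n\in\mathbb N_0,\,n>N}\left(\frac1{\nu(2\pi\tilde n)^2+1}+\frac{|\nu_3\nu-1|}{(\nu(2\pi\tilde n)^2+1)((2\pi\tilde n)^2+\nu_3)}+\frac1{(2\pi\tilde n)^2+\nu_3}\right)$. Here $A_pDF_p(\overline{\mathbf U})$ is understood modewise; it defines a bounded operator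 on $\ell^1_{e,\tau}$. *)

theory Defs
  imports "HOL-Analysis.Analysis" "HOL-Library.Function_Algebras"
begin

text \<open>Sequences are total functions \<^typ>\<open>nat \<Rightarrow> real\<close>; addition, subtraction and negation of sequences
  (and of pairs of sequences) are pointwise. The pointwise product and the constant sequence 1
  of \<^theory>\<open>HOL-Library.Function_Algebras\<close> are not used: products are the convolution
  \<open>\<star>\<close> below, and a scalar \<open>c\<close> added to a sequence is written \<open>c \<cdot> e0\<close>.\<close>

type_synonym seq = "nat \<Rightarrow> real"

definition weight :: "nat \<Rightarrow> real" where
  "weight n = (if n = 0 then 1 else 2)"

definition ell1 :: "real \<Rightarrow> seq set" where
  "ell1 \<tau> = {U. (\<lambda>n. weight n * \<bar>U n\<bar> * \<tau> ^ n) summable_on UNIV}"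

definition norm1 :: "real \<Rightarrow> seq \<Rightarrow> real" where
  "norm1 \<tau> U = (\<Sum>\<^sub>\<infinity>n. weight n * \<bar>U n\<bar> * \<tau> ^ n)"

definition e0 :: seq where
  "e0 n = (if n = 0 then 1 else 0)"

definition sscale :: "real \<Rightarrow> seq \<Rightarrow> seq" (infixr "\<cdot>" 75) where
  "c \<cdot> U = (\<lambda>n. c * U n)"

definition conv :: "seq \<Rightarrow> seq \<Rightarrow> seq" (infixl "\<star>" 70) where
  "U \<star> V = (\<lambda>n. \<Sum>\<^sub>\<infinity>k\<in>(UNIV :: int set). U (nat \<bar>int n - k\<bar>) * V (nat \<bar>k\<bar>))"

text \<open>The inverse in the Banach algebra \<open>ell1 \<tau>\<close>; unspecified if \<open>U\<close> is not invertible there.\<close>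

definition conv_inv :: "real \<Rightarrow> seq \<Rightarrow> seq" where
  "conv_inv \<tau> U = (THE V. V \<in> ell1 \<tau> \<and> U \<star> V = e0)"

definition proj_le :: "nat \<Rightarrow> seq \<Rightarrow> seq" where
  "proj_le M U = (\<lambda>n. if n \<le> M then U n else 0)"

definition ell1e :: "real \<Rightarrow> (seq \<times> seq) set" where
  "ell1e \<tau> = ell1 \<tau> \<times> ell1 \<tau>"

definition pnorm :: "real \<Rightarrow> seq \<times> seq \<Rightarrow> real" where
  "pnorm \<tau> U = norm1 \<tau> (fst U) + norm1 \<tau> (snd U)"

definition pscale :: "real \<Rightarrow> seq \<times> seq \<Rightarrow> seq \<times> seq" where
  "pscale c U = (c \<cdot> fst U, c \<cdot> snd U)"

definition pproj_le :: "nat \<Rightarrow> seq \<times> seq \<Rightarrow> seq \<times> seq" where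
  "pproj_le M U = (proj_le M (fst U), proj_le M (snd U))"

definition linear_op_on :: "(seq \<times> seq) set \<Rightarrow> (seq \<times> seq \<Rightarrow> seq \<times> seq) \<Rightarrow> bool" where
  "linear_op_on S T \<longleftrightarrow>
     (\<forall>U\<in>S. \<forall>V\<in>S. T (U + V) = T U + T V) \<and> (\<forall>c. \<forall>U\<in>S. T (pscale c U) = pscale c (T U))"

definition bounded_op :: "real \<Rightarrow> (seq \<times> seq \<Rightarrow> seq \<times> seq) \<Rightarrow> bool" where
  "bounded_op \<tau> T \<longleftrightarrow> linear_op_on (ell1e \<tau>) T \<and> T ` ell1e \<tau> \<subseteq> ell1e \<tau> \<and>
     (\<exists>C. \<forall>U\<in>ell1e \<tau>. pnorm \<tau> (T U) \<le> C * pnorm \<tau> U)"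

text \<open>The operator norm on \<open>ell1e \<tau>\<close>; meaningful only for operators satisfying \<open>bounded_op \<tau>\<close>.\<close>

definition opnorm :: "real \<Rightarrow> (seq \<times> seq \<Rightarrow> seq \<times> seq) \<Rightarrow> real" where
  "opnorm \<tau> T = (SUP U\<in>{U\<in>ell1e \<tau>. pnorm \<tau> U \<le> 1}. pnorm \<tau> (T U))"

text \<open>\<open>(2 \<pi> n~)\<^sup>2\<close> with \<open>n~ = n / (2 d)\<close>\<close>

definition freq2 :: "real \<Rightarrow> nat \<Rightarrow> real" where
  "freq2 d n = (2 * pi * (real n / (2 * d)))\<^sup>2"

text \<open>\<open>Lp\<close> acts modewise on all pairs of sequences, so it is not restricted to a domain on which
  it takes values in \<open>ell1e \<tau>\<close>; the same holds for \<open>Ap\<close>.\<close>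

definition Lp :: "real \<Rightarrow> real \<Rightarrow> real \<Rightarrow> seq \<times> seq \<Rightarrow> seq \<times> seq" where
  "Lp d \<nu> \<nu>3 U =
     (\<lambda>n. - (\<nu> * freq2 d n + 1) * fst U n,
      \<lambda>n. (\<nu>3 * \<nu> - 1) * fst U n - (freq2 d n + \<nu>3) * snd U n)"

definition DG_op :: "seq \<Rightarrow> seq \<Rightarrow> seq \<times> seq \<Rightarrow> seq \<times> seq" where
  "DG_op V1 V2 U = (V1 \<star> fst U + V2 \<star> snd U, 0)"

definition Ap :: "real \<Rightarrow> real \<Rightarrow> real \<Rightarrow> nat \<Rightarrow> (seq \<times> seq \<Rightarrow> seq \<times> seq) \<Rightarrow> seq \<times> seq \<Rightarrow> seq \<times> seq" where
  "Ap d \<nu> \<nu>3 N AN H =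
     (\<lambda>n. if n \<le> N then fst (AN (pproj_le N H)) n
          else - (fst H n / (\<nu> * freq2 d n + 1)),
      \<lambda>n. if n \<le> N then snd (AN (pproj_le N H)) n
          else - ((\<nu>3 * \<nu> - 1) * fst H n / ((\<nu> * freq2 d n + 1) * (freq2 d n + \<nu>3))
                  + snd H n / (freq2 d n + \<nu>3)))"

text \<open>For \<open>d, \<nu>, \<nu>3 > 0\<close> the terms decrease in \<open>n\<close>, so the supremum is a maximum, attained at
  \<open>N + 1\<close>.\<close>

definition Linf :: "real \<Rightarrow> real \<Rightarrow> real \<Rightarrow> nat \<Rightarrow> real" where
  "Linf d \<nu> \<nu>3 N =
     (SUP n\<in>{N<..}. 1 / (\<nu> * freq2 d n + 1)
        + \<bar>\<nu>3 * \<nu> - 1\<bar> / ((\<nu> * freq2 d n + 1) * (freq2 d n + \<nu>3))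
        + 1 / (freq2 d n + \<nu>3))"

end

theory Submission
  imports Defs
begin

text \<open>
  Write \<open>L\<close> for \<open>Lp\<close> and \<open>DGN\<close> for the operator of convolution by the truncations \<open>V1N\<close>, \<open>V2N\<close>. The bound
  comes from an exact decomposition (\<open>residual_decomposition\<close>) of \<open>U - A (L U + DG U)\<close> into three parts.

  The first part is the block \<open>B U\<close> of modes at most \<open>N\<close> of \<open>U - A (L U + DGN U)\<close>. Since \<open>V1N\<close>, \<open>V2N\<close>
  have no mode beyond \<open>N\<close>, convolution by them lets only the modes of \<open>U\<close> up to \<open>2 N\<close> reach
  output modes up to \<open>N\<close>; so \<open>U\<close> may be replaced by its projection to modes at most \<open>2 N\<close>, which
  gives the computable norm in \<open>Z1\<close>.

  The second part lives on the modes above \<open>N\<close>. There \<open>A\<close> inverts \<open>L\<close> exactly, so only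
  \<open>- A (DGN U)\<close> survives, and the entries of the inverse of \<open>L\<close> on these modes are controlled by
  \<open>Linf\<close>.

  The third part is \<open>A\<close> applied to the truncation error \<open>DG U - DGN U\<close>, a convolution by
  \<open>V1 - V1N\<close> and \<open>V2 - V2N\<close>. To compare \<open>V1\<close>, \<open>V2\<close> with their approximations \<open>W1\<close>, \<open>W2\<close>, let \<open>P\<close> be
  an approximate inverse of \<open>\<Phi>\<close> with error \<open>R = e0 - \<Phi> \<star> P\<close> of norm less than \<open>1\<close>. A Neumann series
  gives \<open>S\<close> with \<open>(e0 - R) \<star> S = e0\<close>, the true inverse is \<open>I = P \<star> S\<close>, and \<open>S - e0 = R \<star> S\<close> turns
  \<open>\<Psi> \<star> I - \<Psi> \<star> P\<close> into \<open>\<Psi> \<star> P \<star> R \<star> S\<close> (\<open>approximate_inverse_error\<close>). For \<open>V1\<close> the same is done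
  with the squares \<open>\<Phi> \<star> \<Phi>\<close> and \<open>P \<star> P\<close>.

  All this uses that \<open>ell1 \<tau>\<close> is a commutative Banach algebra, which is proved first. The series in
  \<open>\<star>\<close> converge only for suitable arguments, so most algebraic laws carry membership hypotheses.
\<close>

section \<open>Sequences as even functions on the integers\<close>

text \<open>The even extension turns \<open>\<star>\<close> into the ordinary convolution on the group of integers, where
  associativity and commutativity are translations and reflections of the summation index.\<close>

definition zext :: "seq \<Rightarrow> int \<Rightarrow> real" where
  "zext U k = U (nat \<bar>k\<bar>)"

lemma zext_int [simp]: "zext U (int n) = U n"
  by (simp add: zext_def)

text \<open>Every positive \<open>n\<close> is hit by the two integers \<open>n\<close> and \<open>- n\<close>, which is where \<open>weight\<close> comes
  from. Hence \<open>norm1\<close> is a plain weighted norm of the even extension.\<close>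

lemma has_sum_even_extension:
  fixes f :: "nat \<Rightarrow> real"
  shows "((\<lambda>n. weight n * f n) has_sum s) UNIV \<longleftrightarrow> ((\<lambda>k::int. f (nat \<bar>k\<bar>)) has_sum s) UNIV"
proof -
  have *: "((\<lambda>n. weight n * f n) has_sum (a + b)) UNIV \<and> ((\<lambda>k::int. f (nat \<bar>k\<bar>)) has_sum (a + b)) UNIV"
    if a: "(f has_sum a) UNIV" and b: "(f has_sum b) {1..}" for a b
  proof
    have b': "((\<lambda>n. if n = 0 then 0 else f n) has_sum b) UNIV"
      using b by (subst has_sum_cong_neutral[where T = "{1..}" and g = f]) auto
    show "((\<lambda>n. weight n * f n) has_sum (a + b)) UNIV"
      using has_sum_add[OF a b'] by (rule has_sum_cong[THEN iffD1, rotated]) (auto simp: weight_def)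
    have "((\<lambda>k::int. f (nat \<bar>k\<bar>)) has_sum a) (int ` UNIV)"
      using a by (subst has_sum_reindex) (auto simp: o_def)
    moreover have "((\<lambda>k::int. f (nat \<bar>k\<bar>)) has_sum b) ((\<lambda>n. - int n) ` {1..})"
      using b by (subst has_sum_reindex) (auto simp: o_def inj_on_def)
    ultimately have "((\<lambda>k::int. f (nat \<bar>k\<bar>)) has_sum (a + b)) (int ` UNIV \<union> (\<lambda>n. - int n) ` {1..})"
      by (rule has_sum_Un_disjoint) auto
    moreover have "int ` UNIV \<union> (\<lambda>n. - int n) ` {1..} = UNIV"
    proof -
      have "k \<in> int ` UNIV \<union> (\<lambda>n. - int n) ` {1..}" for k
        by (cases k) (auto intro: rev_image_eqI)
      then show ?thesis by blast
    qed
    ultimately show "((\<lambda>k::int. f (nat \<bar>k\<bar>)) has_sum (a + b)) UNIV"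
      by simp
  qed
  have sub: "f summable_on {1..}" if "f summable_on UNIV"
    using summable_on_subset_banach[OF that] by simp
  show ?thesis
  proof
    assume l: "((\<lambda>n. weight n * f n) has_sum s) UNIV"
    then have "(\<lambda>n. weight n * f n) summable_on {1..}"
      using summable_on_subset_banach summable_on_def by blast
    then have "(\<lambda>n. 2 * f n) summable_on {1..}"
      by (rule summable_on_cong[THEN iffD1, rotated]) (auto simp: weight_def)
    then have 1: "f summable_on {1..}"
      by (subst (asm) summable_on_cmult_right') auto
    have "(UNIV :: nat set) = insert 0 {1..}"
      by auto
    then have "f summable_on UNIV"
      using 1 by (metis summable_on_insert_iff)
    then obtain a b where "(f has_sum a) UNIV" "(f has_sum b) {1..}"
      using 1 has_sum_infsum by blast
    from *[OF this] l show "((\<lambda>k::int. f (nat \<bar>k\<bar>)) has_sum s) UNIV"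
      using has_sum_unique by blast
  next
    assume r: "((\<lambda>k::int. f (nat \<bar>k\<bar>)) has_sum s) UNIV"
    then have "(\<lambda>k::int. f (nat \<bar>k\<bar>)) summable_on (int ` UNIV)"
      using summable_on_subset_banach summable_on_def by blast
    then have "f summable_on UNIV"
      by (subst (asm) summable_on_reindex) (auto simp: o_def)
    then obtain a b where "(f has_sum a) UNIV" "(f has_sum b) {1..}"
      using sub has_sum_infsum by blast
    from *[OF this] r show "((\<lambda>n. weight n * f n) has_sum s) UNIV"
      using has_sum_unique by blast
  qed
qed

definition zweighted :: "real \<Rightarrow> seq \<Rightarrow> int \<Rightarrow> real" where
  "zweighted \<tau> U k = \<bar>zext U k\<bar> * \<tau> ^ nat \<bar>k\<bar>"

lemma ell1_iff_zweighted: "U \<in> ell1 \<tau> \<longleftrightarrow> zweighted \<tau> U summable_on UNIV"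
  using has_sum_even_extension[of "\<lambda>n. \<bar>U n\<bar> * \<tau> ^ n"]
  unfolding ell1_def summable_on_def zweighted_def[abs_def] zext_def by (auto simp: mult.assoc)

lemma has_sum_zweighted:
  assumes "U \<in> ell1 \<tau>"
  shows "(zweighted \<tau> U has_sum norm1 \<tau> U) UNIV"
proof -
  have "((\<lambda>n. weight n * (\<bar>U n\<bar> * \<tau> ^ n)) has_sum norm1 \<tau> U) UNIV"
    using assms unfolding ell1_def norm1_def by (simp add: mult.assoc)
  from has_sum_even_extension[THEN iffD1, OF this] show ?thesis
    by (simp add: zweighted_def[abs_def] zext_def)
qed

text \<open>The shear \<open>(m, k) \<mapsto> (m - k, k)\<close> preserves the lattice of pairs of integers, so the double series
  is a rearrangement of the product of two series. Nonnegativity makes summability free; the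
  general case is always reduced to this one by comparison.\<close>

lemma has_sum_convolution_product:
  fixes a b :: "int \<Rightarrow> real"
  assumes a: "(a has_sum A) UNIV" "\<And>k. 0 \<le> a k"
    and b: "(b has_sum B) UNIV" "\<And>k. 0 \<le> b k"
  shows "((\<lambda>(m, k). a (m - k) * b k) has_sum (A * B)) (UNIV \<times> UNIV)"
proof -
  have inner: "((\<lambda>m. b k * a (m - k)) has_sum (b k * A)) UNIV" for k
  proof -
    have "bij (\<lambda>m::int. m - k)"
      by (rule bij_betw_byWitness[where f' = "\<lambda>m. m + k"]) auto
    then have "((\<lambda>m. a (m - k)) has_sum A) UNIV"
      using has_sum_reindex_bij_betw[of "\<lambda>m::int. m - k" UNIV UNIV a A] a by simp
    then show ?thesis by (rule has_sum_cmult_right)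
  qed
  have outer: "((\<lambda>k. b k * A) has_sum (B * A)) UNIV"
    using b by (intro has_sum_cmult_left)
  have "(\<lambda>(k, m). b k * a (m - k)) summable_on (UNIV \<times> UNIV)"
    using inner outer a(2) b(2)
    by (intro summable_on_SigmaI[where g = "\<lambda>k. b k * A"]) (auto simp: summable_on_def)
  then have "((\<lambda>(k, m). b k * a (m - k)) has_sum (B * A)) (UNIV \<times> UNIV)"
    using inner outer by (intro has_sum_SigmaI[where g = "\<lambda>k. b k * A"]) auto
  from has_sum_swap[THEN iffD1, OF this] show ?thesis
    by (simp add: case_prod_unfold mult.commute)
qed

text \<open>For negative \<open>m\<close> the substitution \<open>k \<mapsto> - k\<close> reduces to the definition of \<open>\<star>\<close>, which only
  mentions nonnegative \<open>m\<close>.\<close>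

lemma zext_conv: "zext (U \<star> V) m = (\<Sum>\<^sub>\<infinity>k. zext U (m - k) * zext V k)"
proof (cases "0 \<le> m")
  case True
  then show ?thesis by (simp add: zext_def conv_def)
next
  case False
  have "bij (uminus :: int \<Rightarrow> int)"
    by (rule bij_betw_byWitness[where f' = uminus]) auto
  then have "(\<Sum>\<^sub>\<infinity>k. zext U (m - k) * zext V k) = (\<Sum>\<^sub>\<infinity>k. zext U (m - (- k)) * zext V (- k))"
    using infsum_reindex_bij_betw[of "uminus :: int \<Rightarrow> int" UNIV UNIV "\<lambda>k. zext U (m - k) * zext V k"]
    by simp
  also have "\<dots> = zext (U \<star> V) m"
  proof -
    have "nat \<bar>m - (- k)\<bar> = nat \<bar>int (nat \<bar>m\<bar>) - k\<bar>" for k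
      using False by simp
    then show ?thesis by (simp add: zext_def conv_def)
  qed
  finally show ?thesis ..
qed

lemma conv_zext: "(U \<star> V) n = (\<Sum>\<^sub>\<infinity>k. zext U (int n - k) * zext V k)"
  using zext_conv[of U V "int n"] by simp

lemma conv_commute: "U \<star> V = V \<star> U"
proof
  fix n
  have "bij (\<lambda>k. int n - k)"
    by (rule bij_betw_byWitness[where f' = "\<lambda>k. int n - k"]) auto
  from infsum_reindex_bij_betw[OF this, of "\<lambda>k. zext U (int n - k) * zext V k"]
  show "(U \<star> V) n = (V \<star> U) n"
    by (simp add: conv_zext mult.commute)
qed

lemma conv_e0 [simp]: "e0 \<star> U = U" "U \<star> e0 = U"
proof -
  show *: "U \<star> e0 = U"
  proof
    fix n
    have "((\<lambda>k. zext U (int n - k) * zext e0 k) has_sum U n) UNIV"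
      by (rule has_sum_finite_neutralI[where B = "{0}"]) (auto simp: zext_def e0_def)
    then show "(U \<star> e0) n = U n"
      by (simp add: conv_zext infsumI)
  qed
  then show "e0 \<star> U = U"
    by (simp add: conv_commute)
qed

lemma conv_sscale_right: "U \<star> (c \<cdot> V) = c \<cdot> (U \<star> V)"
proof
  fix n
  have "(\<lambda>k. zext U (int n - k) * zext (c \<cdot> V) k) = (\<lambda>k. c * (zext U (int n - k) * zext V k))"
    by (auto simp: zext_def sscale_def)
  then show "(U \<star> (c \<cdot> V)) n = (c \<cdot> (U \<star> V)) n"
    by (simp add: conv_zext infsum_cmult_right' sscale_def)
qed

section \<open>The normed space of weighted summable sequences\<close>

lemma norm1_nonneg: "0 \<le> \<tau> \<Longrightarrow> 0 \<le> norm1 \<tau> U"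
  unfolding norm1_def by (intro infsum_nonneg) (auto simp: weight_def)

lemma norm1_minus [simp]: "norm1 \<tau> (- U) = norm1 \<tau> U"
  by (simp add: norm1_def)

lemma norm1_minus_commute: "norm1 \<tau> (U - V) = norm1 \<tau> (V - U)"
  by (simp add: norm1_def abs_minus_commute)

lemma ell1_minus [simp]: "- U \<in> ell1 \<tau> \<longleftrightarrow> U \<in> ell1 \<tau>"
  by (simp add: ell1_def)

lemma sscale_in_ell1:
  assumes "U \<in> ell1 \<tau>"
  shows "c \<cdot> U \<in> ell1 \<tau>" and "norm1 \<tau> (c \<cdot> U) = \<bar>c\<bar> * norm1 \<tau> U"
proof -
  have eq: "(\<lambda>n. weight n * \<bar>(c \<cdot> U) n\<bar> * \<tau> ^ n) = (\<lambda>n. \<bar>c\<bar> * (weight n * \<bar>U n\<bar> * \<tau> ^ n))"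
    by (auto simp: sscale_def abs_mult)
  show "c \<cdot> U \<in> ell1 \<tau>"
    using assms unfolding ell1_def mem_Collect_eq eq by (rule summable_on_cmult_right)
  show "norm1 \<tau> (c \<cdot> U) = \<bar>c\<bar> * norm1 \<tau> U"
    unfolding norm1_def eq by (rule infsum_cmult_right')
qed

lemma norm1_mono:
  assumes "0 \<le> \<tau>" "V \<in> ell1 \<tau>" "\<And>n. \<bar>U n\<bar> \<le> \<bar>V n\<bar>"
  shows "U \<in> ell1 \<tau>" and "norm1 \<tau> U \<le> norm1 \<tau> V"
proof -
  have le: "weight n * \<bar>U n\<bar> * \<tau> ^ n \<le> weight n * \<bar>V n\<bar> * \<tau> ^ n" for n
    using assms(1) assms(3)[of n] by (intro mult_right_mono mult_left_mono) (auto simp: weight_def)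
  show *: "U \<in> ell1 \<tau>"
    unfolding ell1_def mem_Collect_eq
  proof (rule summable_on_comparison_test)
    show "(\<lambda>n. weight n * \<bar>V n\<bar> * \<tau> ^ n) summable_on UNIV"
      using assms(2) by (simp add: ell1_def)
    show "weight n * \<bar>U n\<bar> * \<tau> ^ n \<le> weight n * \<bar>V n\<bar> * \<tau> ^ n" for n
      by (rule le)
    show "0 \<le> weight n * \<bar>U n\<bar> * \<tau> ^ n" for n
      using assms(1) by (simp add: weight_def)
  qed
  show "norm1 \<tau> U \<le> norm1 \<tau> V"
    unfolding norm1_def using * assms(2) le by (intro infsum_mono) (auto simp: ell1_def)
qed

lemma norm1_triangle:
  assumes "0 \<le> \<tau>" "U \<in> ell1 \<tau>" "V \<in> ell1 \<tau>"
  shows "U + V \<in> ell1 \<tau>" and "norm1 \<tau> (U + V) \<le> norm1 \<tau> U + norm1 \<tau> V"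
proof -
  let ?f = "\<lambda>U n. weight n * \<bar>U n\<bar> * \<tau> ^ n"
  have s: "(\<lambda>n. ?f U n + ?f V n) summable_on UNIV"
    using assms by (intro summable_on_add) (auto simp: ell1_def)
  have le: "?f (U + V) n \<le> ?f U n + ?f V n" for n
  proof -
    have "?f (U + V) n \<le> weight n * (\<bar>U n\<bar> + \<bar>V n\<bar>) * \<tau> ^ n"
      using assms(1) by (intro mult_right_mono mult_left_mono) (auto simp: weight_def)
    then show ?thesis by (simp add: algebra_simps)
  qed
  show *: "U + V \<in> ell1 \<tau>"
    unfolding ell1_def mem_Collect_eq
    by (rule summable_on_comparison_test[OF s le]) (use assms(1) in \<open>simp add: weight_def\<close>)
  have "norm1 \<tau> (U + V) \<le> (\<Sum>\<^sub>\<infinity>n. ?f U n + ?f V n)"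
    unfolding norm1_def using * le s by (intro infsum_mono) (auto simp: ell1_def)
  also have "\<dots> = norm1 \<tau> U + norm1 \<tau> V"
    unfolding norm1_def using assms by (intro infsum_add) (auto simp: ell1_def)
  finally show "norm1 \<tau> (U + V) \<le> norm1 \<tau> U + norm1 \<tau> V" .
qed

lemma ell1_diff:
  assumes "0 \<le> \<tau>" "U \<in> ell1 \<tau>" "V \<in> ell1 \<tau>"
  shows "U - V \<in> ell1 \<tau>" and "norm1 \<tau> (U - V) \<le> norm1 \<tau> U + norm1 \<tau> V"
  using norm1_triangle[of \<tau> U "- V"] assms by (auto simp: fun_diff_def plus_fun_def)

lemma finite_support_in_ell1:
  assumes "\<And>n. n > M \<Longrightarrow> U n = 0"
  shows "U \<in> ell1 \<tau>"
proof -
  have "((\<lambda>n. weight n * \<bar>U n\<bar> * \<tau> ^ n) has_sum (\<Sum>n\<le>M. weight n * \<bar>U n\<bar> * \<tau> ^ n)) UNIV"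
    using assms by (intro has_sum_finite_neutralI[where B = "{..M}"]) auto
  then show ?thesis
    unfolding ell1_def summable_on_def by blast
qed

lemma proj_le_in_ell1 [simp]: "proj_le M U \<in> ell1 \<tau>"
  by (rule finite_support_in_ell1[where M = M]) (simp add: proj_le_def)

lemma e0_in_ell1 [simp]: "e0 \<in> ell1 \<tau>"
  by (rule finite_support_in_ell1[where M = 0]) (simp add: e0_def)

lemma zero_in_ell1 [simp]: "0 \<in> ell1 \<tau>"
  by (rule finite_support_in_ell1[where M = 0]) simp

lemma norm1_zero [simp]: "norm1 \<tau> 0 = 0"
  by (simp add: norm1_def)

lemma norm1_e0 [simp]: "norm1 \<tau> e0 = 1"
proof -
  have "((\<lambda>n. weight n * \<bar>e0 n\<bar> * \<tau> ^ n) has_sum 1) UNIV"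
    by (rule has_sum_finite_neutralI[where B = "{0}"]) (auto simp: e0_def weight_def)
  then show ?thesis by (simp add: norm1_def infsumI)
qed

lemma abs_le_norm1:
  assumes "1 \<le> \<tau>" "U \<in> ell1 \<tau>"
  shows "\<bar>U n\<bar> \<le> norm1 \<tau> U"
proof -
  have "1 * \<bar>U n\<bar> * 1 \<le> weight n * \<bar>U n\<bar> * \<tau> ^ n"
    using assms by (intro mult_mono) (auto simp: weight_def)
  also have "\<dots> = (\<Sum>n\<in>{n}. weight n * \<bar>U n\<bar> * \<tau> ^ n)"
    by simp
  also have "\<dots> \<le> norm1 \<tau> U"
    unfolding norm1_def using assms
    by (intro finite_sum_le_infsum) (auto simp: ell1_def weight_def)
  finally show ?thesis by simp
qed

section \<open>The convolution algebra\<close>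

lemma zweighted_nonneg: "0 \<le> \<tau> \<Longrightarrow> 0 \<le> zweighted \<tau> U k"
  by (simp add: zweighted_def)

lemma abs_zext_le_zweighted:
  assumes "1 \<le> \<tau>"
  shows "\<bar>zext U k\<bar> \<le> zweighted \<tau> U k"
  using mult_left_mono[of 1 "\<tau> ^ nat \<bar>k\<bar>" "\<bar>zext U k\<bar>"] one_le_power[OF assms]
  by (simp add: zweighted_def)

lemma abs_zext_le_norm1:
  assumes "1 \<le> \<tau>" "U \<in> ell1 \<tau>"
  shows "\<bar>zext U k\<bar> \<le> norm1 \<tau> U"
  using abs_le_norm1[OF assms] by (simp add: zext_def)

lemma conv_products_summable:
  assumes "1 \<le> \<tau>" "U \<in> ell1 \<tau>" "V \<in> ell1 \<tau>"
  shows "(\<lambda>k. zweighted \<tau> U (m - k) * zweighted \<tau> V k) summable_on UNIV"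
    and "(\<lambda>k. norm (zext U (m - k) * zext V k)) summable_on UNIV"
    and "((\<lambda>m. \<Sum>\<^sub>\<infinity>k. zweighted \<tau> U (m - k) * zweighted \<tau> V k) has_sum norm1 \<tau> U * norm1 \<tau> V) UNIV"
proof -
  have nn: "0 \<le> zweighted \<tau> X k" for X k
    using assms(1) by (intro zweighted_nonneg) simp
  have hs: "((\<lambda>(m, k). zweighted \<tau> U (m - k) * zweighted \<tau> V k) has_sum norm1 \<tau> U * norm1 \<tau> V)
      (UNIV \<times> UNIV)"
    using assms by (intro has_sum_convolution_product has_sum_zweighted nn)
  then have "(\<lambda>(m, k). zweighted \<tau> U (m - k) * zweighted \<tau> V k) summable_on (UNIV \<times> UNIV)"
    using summable_on_def by blast
  from summable_on_SigmaD1[OF this]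
  show row: "(\<lambda>k. zweighted \<tau> U (m - k) * zweighted \<tau> V k) summable_on UNIV" for m
    by simp
  show "(\<lambda>k. norm (zext U (m - k) * zext V k)) summable_on UNIV"
  proof (rule summable_on_comparison_test[OF row])
    show "norm (zext U (m - k) * zext V k) \<le> zweighted \<tau> U (m - k) * zweighted \<tau> V k" for k
      using abs_zext_le_zweighted[OF assms(1)] by (simp add: abs_mult mult_mono nn)
  qed simp
  show "((\<lambda>m. \<Sum>\<^sub>\<infinity>k. zweighted \<tau> U (m - k) * zweighted \<tau> V k) has_sum norm1 \<tau> U * norm1 \<tau> V) UNIV"
    by (rule has_sum_SigmaD[OF hs]) (use has_sum_infsum[OF row] in simp)
qed

text \<open>Because \<open>\<tau> \<ge> 1\<close>, the weight \<open>\<tau> ^ \<bar>m\<bar>\<close> is submultiplicative: it is at most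
  \<open>\<tau> ^ \<bar>m - k\<bar> * \<tau> ^ \<bar>k\<bar>\<close>, so the terms of the weighted double series are
  dominated by products of weighted terms.\<close>

lemma conv_in_ell1:
  assumes "1 \<le> \<tau>" "U \<in> ell1 \<tau>" "V \<in> ell1 \<tau>"
  shows "U \<star> V \<in> ell1 \<tau>" and "norm1 \<tau> (U \<star> V) \<le> norm1 \<tau> U * norm1 \<tau> V"
proof -
  let ?P = "\<lambda>m k. zweighted \<tau> U (m - k) * zweighted \<tau> V k"
  note prods = conv_products_summable[OF assms]
  have le: "zweighted \<tau> (U \<star> V) m \<le> (\<Sum>\<^sub>\<infinity>k. ?P m k)" for m
  proof -
    have term_le: "norm (zext U (m - k) * zext V k) * \<tau> ^ nat \<bar>m\<bar> \<le> ?P m k" for k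
    proof -
      have "\<tau> ^ nat \<bar>m\<bar> \<le> \<tau> ^ (nat \<bar>m - k\<bar> + nat \<bar>k\<bar>)"
        using assms(1) by (intro power_increasing) auto
      then have "norm (zext U (m - k) * zext V k) * \<tau> ^ nat \<bar>m\<bar>
          \<le> norm (zext U (m - k) * zext V k) * \<tau> ^ (nat \<bar>m - k\<bar> + nat \<bar>k\<bar>)"
        by (rule mult_left_mono) simp
      then show ?thesis
        by (simp add: zweighted_def power_add abs_mult mult_ac)
    qed
    have "zweighted \<tau> (U \<star> V) m \<le> (\<Sum>\<^sub>\<infinity>k. norm (zext U (m - k) * zext V k)) * \<tau> ^ nat \<bar>m\<bar>"
      using norm_infsum_bound[OF prods(2)] assms(1)
      by (simp add: zweighted_def zext_conv mult_right_mono)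
    also have "\<dots> = (\<Sum>\<^sub>\<infinity>k. norm (zext U (m - k) * zext V k) * \<tau> ^ nat \<bar>m\<bar>)"
      by (simp add: infsum_cmult_left')
    also have "\<dots> \<le> (\<Sum>\<^sub>\<infinity>k. ?P m k)"
      using term_le prods(1,2) by (intro infsum_mono summable_on_cmult_left)
    finally show ?thesis .
  qed
  have sum: "(\<lambda>m. \<Sum>\<^sub>\<infinity>k. ?P m k) summable_on UNIV"
    using prods(3) summable_on_def by blast
  then have "zweighted \<tau> (U \<star> V) summable_on UNIV"
    by (rule summable_on_comparison_test) (use le assms(1) in \<open>simp_all add: zweighted_nonneg\<close>)
  then show *: "U \<star> V \<in> ell1 \<tau>"
    by (simp add: ell1_iff_zweighted)
  show "norm1 \<tau> (U \<star> V) \<le> norm1 \<tau> U * norm1 \<tau> V"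
    using has_sum_mono[OF has_sum_zweighted[OF *] prods(3)] le by simp
qed

lemma conv_add_right:
  assumes "1 \<le> \<tau>" "U \<in> ell1 \<tau>" "V \<in> ell1 \<tau>" "W \<in> ell1 \<tau>"
  shows "U \<star> (V + W) = U \<star> V + U \<star> W"
proof
  fix n
  have "(U \<star> (V + W)) n = (\<Sum>\<^sub>\<infinity>k. zext U (int n - k) * zext V k + zext U (int n - k) * zext W k)"
    by (simp add: conv_zext zext_def distrib_left)
  also have "\<dots> = (U \<star> V + U \<star> W) n"
    unfolding plus_fun_apply conv_zext
    by (rule infsum_add; rule abs_summable_summable, rule conv_products_summable(2)[OF assms(1,2)])
      (rule assms)+
  finally show "(U \<star> (V + W)) n = (U \<star> V + U \<star> W) n" .
qed

lemma conv_minus_right: "U \<star> (- V) = - (U \<star> V)"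
proof -
  have "- X = (-1) \<cdot> X" for X
    by (simp add: sscale_def fun_eq_iff)
  then show ?thesis
    by (metis conv_sscale_right)
qed

lemma conv_diff_right:
  assumes "1 \<le> \<tau>" "U \<in> ell1 \<tau>" "V \<in> ell1 \<tau>" "W \<in> ell1 \<tau>"
  shows "U \<star> (V - W) = U \<star> V - U \<star> W"
  using conv_add_right[of \<tau> U V "- W"] assms by (simp add: conv_minus_right)

lemma conv_diff_left:
  assumes "1 \<le> \<tau>" "U \<in> ell1 \<tau>" "V \<in> ell1 \<tau>" "W \<in> ell1 \<tau>"
  shows "(V - W) \<star> U = V \<star> U - W \<star> U"
  using conv_diff_right[OF assms] by (simp add: conv_commute)

text \<open>With \<open>j = i - k\<close> both sides become the same double series over \<open>(i, k)\<close> in two orders of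
  summation; absolute convergence follows since the first factor is bounded.\<close>

lemma conv_assoc:
  assumes "1 \<le> \<tau>" "U \<in> ell1 \<tau>" "V \<in> ell1 \<tau>" "W \<in> ell1 \<tau>"
  shows "U \<star> V \<star> W = U \<star> (V \<star> W)"
proof
  fix n
  define u where "u i = zext U (int n - i)" for i
  have shift: "zext (U \<star> V) (int n - k) = (\<Sum>\<^sub>\<infinity>i. u i * zext V (i - k))" for k
  proof -
    have "bij (\<lambda>i. i - k)"
      by (rule bij_betw_byWitness[where f' = "\<lambda>i. i + k"]) auto
    from infsum_reindex_bij_betw[OF this, of "\<lambda>j. zext U (int n - k - j) * zext V j"]
    show ?thesis by (simp add: zext_conv u_def)
  qed
  have "((\<lambda>(i, k). zweighted \<tau> V (i - k) * zweighted \<tau> W k) has_sum norm1 \<tau> V * norm1 \<tau> W) (UNIV \<times> UNIV)"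
    using assms by (intro has_sum_convolution_product has_sum_zweighted zweighted_nonneg) auto
  then have "(\<lambda>(i, k). zweighted \<tau> V (i - k) * zweighted \<tau> W k) summable_on (UNIV \<times> UNIV)"
    using summable_on_def by blast
  then have "(\<lambda>p. norm1 \<tau> U * (case p of (i, k) \<Rightarrow> zweighted \<tau> V (i - k) * zweighted \<tau> W k))
      summable_on (UNIV \<times> UNIV)"
    by (rule summable_on_cmult_right)
  then have "(\<lambda>p. norm (case p of (i, k) \<Rightarrow> u i * (zext V (i - k) * zext W k))) summable_on (UNIV \<times> UNIV)"
  proof (rule summable_on_comparison_test)
    fix p :: "int \<times> int"
    obtain i k where p: "p = (i, k)" by (cases p)
    have "\<bar>zext V (i - k) * zext W k\<bar> \<le> zweighted \<tau> V (i - k) * zweighted \<tau> W k"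
      using abs_zext_le_zweighted[OF assms(1)] assms(1)
      by (simp add: abs_mult mult_mono zweighted_nonneg)
    then show "norm (case p of (i, k) \<Rightarrow> u i * (zext V (i - k) * zext W k))
        \<le> norm1 \<tau> U * (case p of (i, k) \<Rightarrow> zweighted \<tau> V (i - k) * zweighted \<tau> W k)"
      using abs_zext_le_norm1[OF assms(1,2)] assms(1)
      by (simp add: p u_def abs_mult[of "zext U _"] mult_mono norm1_nonneg)
  qed simp
  then have "(\<lambda>(i, k). u i * (zext V (i - k) * zext W k)) summable_on (UNIV \<times> UNIV)"
    by (rule abs_summable_summable)
  from infsum_swap_banach[OF this]
  have "(\<Sum>\<^sub>\<infinity>i. u i * (\<Sum>\<^sub>\<infinity>k. zext V (i - k) * zext W k))
      = (\<Sum>\<^sub>\<infinity>k. (\<Sum>\<^sub>\<infinity>i. u i * zext V (i - k)) * zext W k)"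
    by (simp add: infsum_cmult_right' infsum_cmult_left' flip: mult.assoc)
       (simp add: infsum_cmult_right' mult.assoc)
  then show "(U \<star> V \<star> W) n = (U \<star> (V \<star> W)) n"
    by (simp add: conv_zext[of "U \<star> V" W] conv_zext[of U "V \<star> W"] shift zext_conv[of V W] u_def)
qed

text \<open>Completeness in the form needed here: a series dominated in norm by a convergent numerical
  series may be summed entrywise, and convolution by \<open>R\<close> acts on it term by term.\<close>

lemma ell1_series:
  fixes X :: "nat \<Rightarrow> seq"
  assumes \<tau>: "1 \<le> \<tau>" and X: "\<And>k. X k \<in> ell1 \<tau>" "\<And>k. norm1 \<tau> (X k) \<le> c k"
    and c: "(c has_sum C) UNIV" and R: "R \<in> ell1 \<tau>"
  defines "S \<equiv> \<lambda>n. \<Sum>\<^sub>\<infinity>k. X k n"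
  shows "(\<lambda>k. X k n) summable_on UNIV" and "S \<in> ell1 \<tau>" and "norm1 \<tau> S \<le> C"
    and "(R \<star> S) n = (\<Sum>\<^sub>\<infinity>k. (R \<star> X k) n)"
proof -
  have nn: "0 \<le> zweighted \<tau> Y k" for Y k
    using \<tau> by (intro zweighted_nonneg) simp
  have normX: "(\<lambda>k. norm1 \<tau> (X k)) summable_on UNIV"
    by (rule summable_on_comparison_test[where f = c])
      (use X c \<tau> in \<open>auto simp: summable_on_def norm1_nonneg\<close>)
  have joint: "(\<lambda>(k, j). zweighted \<tau> (X k) j) summable_on (UNIV \<times> UNIV)"
    by (rule summable_on_SigmaI[where g = "\<lambda>k. norm1 \<tau> (X k)"])
      (use X normX nn has_sum_zweighted in auto)
  then have joint': "(\<lambda>(j, k). zweighted \<tau> (X k) j) summable_on (UNIV \<times> UNIV)"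
    by (subst (asm) summable_on_swap) simp
  then have row: "(\<lambda>k. zweighted \<tau> (X k) j) summable_on UNIV" for j
    using summable_on_SigmaD1[OF joint'] by simp
  have abs_row: "(\<lambda>k. norm (zext (X k) j)) summable_on UNIV" for j
    by (rule summable_on_comparison_test[OF row[of j]])
      (use abs_zext_le_zweighted[OF \<tau>] in auto)
  show "(\<lambda>k. X k n) summable_on UNIV"
    using abs_summable_summable[OF abs_row[of "int n"]] by simp
  have S: "zext S j = (\<Sum>\<^sub>\<infinity>k. zext (X k) j)" for j
    by (simp add: S_def zext_def)
  have le: "zweighted \<tau> S j \<le> (\<Sum>\<^sub>\<infinity>k. zweighted \<tau> (X k) j)" for j
    using norm_infsum_bound[OF abs_row[of j]] \<tau>
    by (simp add: zweighted_def S mult_right_mono infsum_cmult_left')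
  have tot: "((\<lambda>j. \<Sum>\<^sub>\<infinity>k. zweighted \<tau> (X k) j) has_sum (\<Sum>\<^sub>\<infinity>k. norm1 \<tau> (X k))) UNIV"
  proof -
    have "(\<Sum>\<^sub>\<infinity>k. \<Sum>\<^sub>\<infinity>j. zweighted \<tau> (X k) j) = (\<Sum>\<^sub>\<infinity>k. norm1 \<tau> (X k))"
      by (intro infsum_cong infsumI has_sum_zweighted X)
    moreover have "(\<lambda>j. \<Sum>\<^sub>\<infinity>k. zweighted \<tau> (X k) j) summable_on UNIV"
      using summable_on_Sigma_banach[OF joint'] by simp
    ultimately show ?thesis
      using infsum_swap_banach[OF joint] has_sum_infsum by metis
  qed
  show "S \<in> ell1 \<tau>"
    unfolding ell1_iff_zweighted
    by (rule summable_on_comparison_test[of "\<lambda>j. \<Sum>\<^sub>\<infinity>k. zweighted \<tau> (X k) j"])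
      (use tot le nn in \<open>auto simp: summable_on_def\<close>)
  then have "norm1 \<tau> S \<le> (\<Sum>\<^sub>\<infinity>k. norm1 \<tau> (X k))"
    using has_sum_mono[OF has_sum_zweighted tot] le by simp
  also have "\<dots> \<le> C"
    using has_sum_mono[OF has_sum_infsum[OF normX] c] X by simp
  finally show "norm1 \<tau> S \<le> C" .
  have "(\<lambda>p. norm1 \<tau> R * (case p of (j, k) \<Rightarrow> zweighted \<tau> (X k) j)) summable_on (UNIV \<times> UNIV)"
    using joint' by (rule summable_on_cmult_right)
  then have "(\<lambda>p. norm (case p of (j, k) \<Rightarrow> zext R (int n - j) * zext (X k) j)) summable_on (UNIV \<times> UNIV)"
  proof (rule summable_on_comparison_test)
    fix p :: "int \<times> nat"
    show "norm (case p of (j, k) \<Rightarrow> zext R (int n - j) * zext (X k) j)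
        \<le> norm1 \<tau> R * (case p of (j, k) \<Rightarrow> zweighted \<tau> (X k) j)"
      using abs_zext_le_norm1[OF \<tau> R] abs_zext_le_zweighted[OF \<tau>] \<tau>
      by (cases p) (simp add: abs_mult mult_mono norm1_nonneg)
  qed simp
  from infsum_swap_banach[OF abs_summable_summable[OF this]]
  show "(R \<star> S) n = (\<Sum>\<^sub>\<infinity>k. (R \<star> X k) n)"
    by (simp add: conv_zext S infsum_cmult_right')
qed

lemma Neumann_series:
  assumes \<tau>: "1 \<le> \<tau>" and T: "T \<in> ell1 \<tau>" and lt: "norm1 \<tau> (e0 - T) < 1"
  obtains S where "S \<in> ell1 \<tau>" "T \<star> S = e0" "norm1 \<tau> S \<le> 1 / (1 - norm1 \<tau> (e0 - T))"
proof -
  define R where "R = e0 - T"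
  have R: "R \<in> ell1 \<tau>"
    using \<tau> T by (simp add: R_def ell1_diff)
  define X where "X k = ((\<star>) R ^^ k) e0" for k
  have X: "X k \<in> ell1 \<tau> \<and> norm1 \<tau> (X k) \<le> norm1 \<tau> R ^ k" for k
  proof (induction k)
    case 0
    then show ?case by (simp add: X_def)
  next
    case (Suc k)
    then have "norm1 \<tau> (R \<star> X k) \<le> norm1 \<tau> R * norm1 \<tau> R ^ k"
      using conv_in_ell1(2)[OF \<tau> R, of "X k"] \<tau>
      by (meson norm1_nonneg order_trans mult_left_mono zero_le_one)
    then show ?case
      using conv_in_ell1(1)[OF \<tau> R, of "X k"] Suc by (simp add: X_def)
  qed
  have "((\<lambda>k. norm1 \<tau> R ^ k) has_sum (1 / (1 - norm1 \<tau> R))) UNIV"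
  proof (rule norm_summable_imp_has_sum)
    have "norm (norm1 \<tau> R) < 1"
      using lt \<tau> norm1_nonneg[of \<tau> R] by (simp add: R_def)
    then show "(\<lambda>k. norm1 \<tau> R ^ k) sums (1 / (1 - norm1 \<tau> R))"
      and "summable (\<lambda>k. norm (norm1 \<tau> R ^ k))"
      by (auto intro!: geometric_sums summable_geometric simp: norm_power power_abs)
  qed
  note series = ell1_series[of \<tau> X, OF \<tau> _ _ this R]
  define S where "S = (\<lambda>n. \<Sum>\<^sub>\<infinity>k. X k n)"
  have S: "S \<in> ell1 \<tau>" "norm1 \<tau> S \<le> 1 / (1 - norm1 \<tau> R)"
    unfolding S_def using series(2,3) X by blast+
  have "S = e0 + R \<star> S"
  proof
    fix n
    have sum: "(\<lambda>k. X k n) summable_on UNIV"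
      using series(1) X by blast
    have "S n = X 0 n + (\<Sum>\<^sub>\<infinity>k. X (Suc k) n)"
    proof -
      have "(\<lambda>k. X k n) summable_on (Suc ` UNIV)"
        using sum by (rule summable_on_subset_banach) simp
      then have "(\<Sum>\<^sub>\<infinity>k\<in>insert 0 (Suc ` UNIV). X k n) = X 0 n + (\<Sum>\<^sub>\<infinity>k\<in>Suc ` UNIV. X k n)"
        by (rule infsum_insert) simp
      moreover have "insert 0 (Suc ` UNIV) = UNIV"
        using UNIV_nat_eq by simp
      ultimately show ?thesis
        by (simp add: S_def infsum_reindex o_def)
    qed
    also have "(\<Sum>\<^sub>\<infinity>k. X (Suc k) n) = (R \<star> S) n"
      using series(4)[of n] X by (simp add: S_def X_def)
    finally show "S n = (e0 + R \<star> S) n"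
      by (simp add: X_def)
  qed
  moreover have "R \<star> S = S - T \<star> S"
    using conv_diff_left[OF \<tau> S(1) e0_in_ell1 T] by (simp add: R_def)
  ultimately have "T \<star> S = e0"
    by (simp add: algebra_simps)
  with that S show thesis
    by (simp add: R_def)
qed

lemma conv_inv_eqI:
  assumes "1 \<le> \<tau>" "U \<in> ell1 \<tau>" "V \<in> ell1 \<tau>" "U \<star> V = e0"
  shows "conv_inv \<tau> U = V"
  unfolding conv_inv_def
proof (rule the_equality)
  fix W assume W: "W \<in> ell1 \<tau> \<and> U \<star> W = e0"
  have "W = V \<star> U \<star> W"
    using assms(4) by (simp add: conv_commute)
  also have "\<dots> = V \<star> (U \<star> W)"
    using conv_assoc[of \<tau> V U W] assms W by blast
  also have "\<dots> = V"
    using W by simp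
  finally show "W = V" .
qed (use assms in simp)

text \<open>With \<open>R = e0 - \<Phi> \<star> P\<close> and \<open>S\<close> the inverse of \<open>e0 - R\<close>, uniqueness of inverses gives
  \<open>I = P \<star> S\<close>, and \<open>S - e0 = R \<star> S\<close> makes the error a multiple of \<open>\<Psi> \<star> P \<star> R\<close>. Keeping that
  product inside one norm is sharper than bounding its factors separately.\<close>

lemma approximate_inverse_error:
  assumes \<tau>: "1 \<le> \<tau>" and in_ell1: "\<Phi> \<in> ell1 \<tau>" "P \<in> ell1 \<tau>" "I \<in> ell1 \<tau>" "\<Psi> \<in> ell1 \<tau>"
    and I: "\<Phi> \<star> I = e0" and lt: "norm1 \<tau> (e0 - \<Phi> \<star> P) < 1"
  shows "norm1 \<tau> (\<Psi> \<star> I - \<Psi> \<star> P) \<le> norm1 \<tau> (\<Psi> \<star> P \<star> (e0 - \<Phi> \<star> P)) / (1 - norm1 \<tau> (e0 - \<Phi> \<star> P))"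
proof -
  define R where "R = e0 - \<Phi> \<star> P"
  note mem = in_ell1 conv_in_ell1(1)[OF \<tau>]
  obtain S where S: "S \<in> ell1 \<tau>" "\<Phi> \<star> P \<star> S = e0" "norm1 \<tau> S \<le> 1 / (1 - norm1 \<tau> R)"
    using Neumann_series[OF \<tau> _ lt] mem unfolding R_def by blast
  have R: "R \<in> ell1 \<tau>"
    using \<tau> by (simp add: R_def ell1_diff mem)
  have "\<Phi> \<star> (P \<star> S) = e0"
    using S(2) conv_assoc[OF \<tau> in_ell1(1,2) S(1)] by simp
  then have I_eq: "I = P \<star> S"
    using conv_inv_eqI[OF \<tau> in_ell1(1) in_ell1(3) I] conv_inv_eqI[OF \<tau> in_ell1(1) mem(5)[OF in_ell1(2) S(1)]]
    by simp
  have "R \<star> S = S - e0"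
    using conv_diff_left[OF \<tau> S(1) e0_in_ell1 mem(5)[OF in_ell1(1,2)]] S(2) by (simp add: R_def)
  then have "\<Psi> \<star> P \<star> R \<star> S = \<Psi> \<star> P \<star> S - \<Psi> \<star> P"
    using conv_assoc[of \<tau> "\<Psi> \<star> P" R S] conv_diff_right[of \<tau> "\<Psi> \<star> P" S e0] \<tau> R S(1) mem by simp
  also have "\<Psi> \<star> P \<star> S = \<Psi> \<star> I"
    using conv_assoc[OF \<tau> in_ell1(4,2) S(1)] I_eq by simp
  finally have "norm1 \<tau> (\<Psi> \<star> I - \<Psi> \<star> P) = norm1 \<tau> (\<Psi> \<star> P \<star> R \<star> S)"
    by (simp only:)
  also have "\<dots> \<le> norm1 \<tau> (\<Psi> \<star> P \<star> R) * norm1 \<tau> S"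
    using \<tau> R S(1) by (intro conv_in_ell1(2)) (simp_all add: mem)
  also have "\<dots> \<le> norm1 \<tau> (\<Psi> \<star> P \<star> R) * (1 / (1 - norm1 \<tau> R))"
    using S(3) \<tau> by (intro mult_left_mono norm1_nonneg) auto
  finally show ?thesis
    by (simp add: R_def)
qed

lemma approximately_invertible:
  assumes \<tau>: "1 \<le> \<tau>" and "\<Phi> \<in> ell1 \<tau>" "P \<in> ell1 \<tau>" and lt: "norm1 \<tau> (e0 - \<Phi> \<star> P) < 1"
  shows "conv_inv \<tau> \<Phi> \<in> ell1 \<tau>" and "\<Phi> \<star> conv_inv \<tau> \<Phi> = e0"
proof -
  obtain S where S: "S \<in> ell1 \<tau>" "\<Phi> \<star> P \<star> S = e0"
    using Neumann_series[OF \<tau> _ lt] conv_in_ell1(1)[OF assms(1-3)] by blast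
  have *: "P \<star> S \<in> ell1 \<tau>" "\<Phi> \<star> (P \<star> S) = e0"
    using S conv_assoc[OF assms(1-3) S(1)] conv_in_ell1(1)[OF \<tau> assms(3) S(1)] by auto
  then have "conv_inv \<tau> \<Phi> = P \<star> S"
    by (intro conv_inv_eqI assms)
  with * show "conv_inv \<tau> \<Phi> \<in> ell1 \<tau>" "\<Phi> \<star> conv_inv \<tau> \<Phi> = e0"
    by auto
qed

lemma conv_square_inverse:
  assumes \<tau>: "1 \<le> \<tau>" and U: "U \<in> ell1 \<tau>" and V: "V \<in> ell1 \<tau>" and inv: "U \<star> V = e0"
  shows "(U \<star> U) \<star> (V \<star> V) = e0"
proof -
  have "(U \<star> U) \<star> (V \<star> V) = U \<star> (U \<star> V \<star> V)"
    using conv_assoc[OF \<tau> U U conv_in_ell1(1)[OF \<tau> V V]] conv_assoc[OF \<tau> U V V] by simp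
  then show ?thesis
    using inv by simp
qed

section \<open>Pairs of sequences and operator norms\<close>

definition pproj_gt :: "nat \<Rightarrow> seq \<times> seq \<Rightarrow> seq \<times> seq" where
  "pproj_gt N X = X - pproj_le N X"

lemma pproj_gt_entries:
  "fst (pproj_gt N X) n = (if n \<le> N then 0 else fst X n)"
  "snd (pproj_gt N X) n = (if n \<le> N then 0 else snd X n)"
  by (simp_all add: pproj_gt_def pproj_le_def proj_le_def)

lemma pproj_le_entries:
  "fst (pproj_le N X) n = (if n \<le> N then fst X n else 0)"
  "snd (pproj_le N X) n = (if n \<le> N then snd X n else 0)"
  by (simp_all add: pproj_le_def proj_le_def)

lemma pscale_entries:
  "fst (pscale c X) n = c * fst X n"
  "snd (pscale c X) n = c * snd X n"
  by (simp_all add: pscale_def sscale_def)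

lemma pair_seq_eqI:
  fixes X Y :: "seq \<times> seq"
  assumes "\<And>n. fst X n = fst Y n" "\<And>n. snd X n = snd Y n"
  shows "X = Y"
  using assms by (auto simp: prod_eq_iff)

lemma ell1e_iff: "U \<in> ell1e \<tau> \<longleftrightarrow> fst U \<in> ell1 \<tau> \<and> snd U \<in> ell1 \<tau>"
  by (cases U) (simp add: ell1e_def)

lemma ell1e_zero [simp]: "0 \<in> ell1e \<tau>"
  by (simp add: ell1e_iff)

lemma pnorm_zero [simp]: "pnorm \<tau> 0 = 0"
  by (simp add: pnorm_def)

lemma pproj_le_in_ell1e [simp]: "pproj_le M U \<in> ell1e \<tau>"
  by (simp add: ell1e_iff pproj_le_def)

lemma pnorm_nonneg: "0 \<le> \<tau> \<Longrightarrow> 0 \<le> pnorm \<tau> U"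
  by (simp add: pnorm_def norm1_nonneg)

lemma ell1e_add:
  assumes "0 \<le> \<tau>" "U \<in> ell1e \<tau>" "V \<in> ell1e \<tau>"
  shows "U + V \<in> ell1e \<tau>" and "pnorm \<tau> (U + V) \<le> pnorm \<tau> U + pnorm \<tau> V"
  using norm1_triangle[of \<tau> "fst U" "fst V"] norm1_triangle[of \<tau> "snd U" "snd V"] assms
  by (auto simp: ell1e_iff pnorm_def)

lemma ell1e_diff:
  assumes "0 \<le> \<tau>" "U \<in> ell1e \<tau>" "V \<in> ell1e \<tau>"
  shows "U - V \<in> ell1e \<tau>" and "pnorm \<tau> (U - V) \<le> pnorm \<tau> U + pnorm \<tau> V"
  using ell1_diff[of \<tau> "fst U" "fst V"] ell1_diff[of \<tau> "snd U" "snd V"] assms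
  by (auto simp: ell1e_iff pnorm_def)

lemma ell1e_pscale:
  assumes "U \<in> ell1e \<tau>"
  shows "pscale c U \<in> ell1e \<tau>" and "pnorm \<tau> (pscale c U) = \<bar>c\<bar> * pnorm \<tau> U"
  using assms by (auto simp: ell1e_iff pscale_def pnorm_def sscale_in_ell1 distrib_left)

text \<open>Adding the two components before summing lets an entrywise bound by a matrix be measured by
  its column sums, which is how the modes of \<open>A\<close> beyond \<open>N\<close> are estimated.\<close>

lemma ell1e_pointwise_bound:
  assumes "0 \<le> \<tau>" "H \<in> ell1e \<tau>"
    and le: "\<And>n. \<bar>fst X n\<bar> + \<bar>snd X n\<bar> \<le> l * (\<bar>fst H n\<bar> + \<bar>snd H n\<bar>)"
  shows "X \<in> ell1e \<tau>" and "pnorm \<tau> X \<le> \<bar>l\<bar> * pnorm \<tau> H"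
proof -
  have abs_sum: "(\<lambda>n. \<bar>U n\<bar> + \<bar>V n\<bar>) \<in> ell1 \<tau>"
      "norm1 \<tau> (\<lambda>n. \<bar>U n\<bar> + \<bar>V n\<bar>) = norm1 \<tau> U + norm1 \<tau> V"
    if "U \<in> ell1 \<tau>" "V \<in> ell1 \<tau>" for U V
  proof -
    have eq: "(\<lambda>n. weight n * \<bar>\<bar>U n\<bar> + \<bar>V n\<bar>\<bar> * \<tau> ^ n)
        = (\<lambda>n. weight n * \<bar>U n\<bar> * \<tau> ^ n + weight n * \<bar>V n\<bar> * \<tau> ^ n)"
      by (simp add: algebra_simps)
    show "(\<lambda>n. \<bar>U n\<bar> + \<bar>V n\<bar>) \<in> ell1 \<tau>"
      using that unfolding ell1_def mem_Collect_eq eq by (rule summable_on_add)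
    show "norm1 \<tau> (\<lambda>n. \<bar>U n\<bar> + \<bar>V n\<bar>) = norm1 \<tau> U + norm1 \<tau> V"
      using that unfolding norm1_def eq ell1_def mem_Collect_eq by (rule infsum_add)
  qed
  let ?h = "\<lambda>n. \<bar>fst H n\<bar> + \<bar>snd H n\<bar>"
  have h: "?h \<in> ell1 \<tau>" "norm1 \<tau> ?h = pnorm \<tau> H"
    using abs_sum assms(2) by (auto simp: ell1e_iff pnorm_def)
  have lh: "l \<cdot> ?h \<in> ell1 \<tau>" "norm1 \<tau> (l \<cdot> ?h) = \<bar>l\<bar> * pnorm \<tau> H"
    using sscale_in_ell1[OF h(1), of l] h(2) by auto
  have ptw: "\<bar>fst X n\<bar> + \<bar>snd X n\<bar> \<le> \<bar>(l \<cdot> ?h) n\<bar>" for n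
    using le[of n] by (simp add: sscale_def)
  have "fst X \<in> ell1 \<tau>"
  proof (rule norm1_mono(1)[OF assms(1) lh(1)])
    show "\<bar>fst X n\<bar> \<le> \<bar>(l \<cdot> ?h) n\<bar>" for n
      using ptw[of n] by linarith
  qed
  moreover have "snd X \<in> ell1 \<tau>"
  proof (rule norm1_mono(1)[OF assms(1) lh(1)])
    show "\<bar>snd X n\<bar> \<le> \<bar>(l \<cdot> ?h) n\<bar>" for n
      using ptw[of n] by linarith
  qed
  ultimately show "X \<in> ell1e \<tau>" by (simp add: ell1e_iff)
  then have "pnorm \<tau> X = norm1 \<tau> (\<lambda>n. \<bar>fst X n\<bar> + \<bar>snd X n\<bar>)"
    using abs_sum by (auto simp: ell1e_iff pnorm_def)
  also have "\<dots> \<le> norm1 \<tau> (l \<cdot> ?h)"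
    by (rule norm1_mono(2)[OF assms(1) lh(1)]) (simp add: ptw)
  finally show "pnorm \<tau> X \<le> \<bar>l\<bar> * pnorm \<tau> H"
    using lh(2) by simp
qed

lemma linear_op_on_zero:
  assumes "linear_op_on (ell1e \<tau>) T"
  shows "T 0 = 0"
proof -
  have z: "pscale 0 X = 0" for X
    by (rule pair_seq_eqI) (simp_all add: pscale_entries)
  have "T (pscale 0 0) = pscale 0 (T 0)"
    using assms ell1e_zero unfolding linear_op_on_def by blast
  then show ?thesis by (simp add: z)
qed

text \<open>The supremum in \<open>opnorm\<close> is over reals, so it is an upper bound only once the set is known
  to be bounded.\<close>

lemma bounded_op_bdd_above:
  assumes "0 \<le> \<tau>" "bounded_op \<tau> T"
  shows "bdd_above ((\<lambda>U. pnorm \<tau> (T U)) ` {U \<in> ell1e \<tau>. pnorm \<tau> U \<le> 1})"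
proof -
  obtain C where C: "\<And>U. U \<in> ell1e \<tau> \<Longrightarrow> pnorm \<tau> (T U) \<le> C * pnorm \<tau> U"
    using assms(2) unfolding bounded_op_def by blast
  show ?thesis
  proof (rule bdd_aboveI2)
    fix U assume U: "U \<in> {U \<in> ell1e \<tau>. pnorm \<tau> U \<le> 1}"
    have "C * pnorm \<tau> U \<le> \<bar>C\<bar> * 1"
      using U pnorm_nonneg[OF assms(1), of U] by (intro mult_mono) auto
    then show "pnorm \<tau> (T U) \<le> \<bar>C\<bar>"
      using C[of U] U by auto
  qed
qed

lemma opnorm_nonneg:
  assumes "0 \<le> \<tau>" "bounded_op \<tau> T"
  shows "0 \<le> opnorm \<tau> T"
proof -
  have "pnorm \<tau> (T 0) \<le> opnorm \<tau> T"
    unfolding opnorm_def by (rule cSUP_upper[OF _ bounded_op_bdd_above[OF assms]]) simp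
  then show ?thesis
    using pnorm_nonneg[OF assms(1), of "T 0"] by linarith
qed

lemma pnorm_le_opnorm:
  assumes "0 \<le> \<tau>" "bounded_op \<tau> T" "U \<in> ell1e \<tau>"
  shows "pnorm \<tau> (T U) \<le> opnorm \<tau> T * pnorm \<tau> U"
proof (cases "pnorm \<tau> U = 0")
  case True
  then show ?thesis
    using assms unfolding bounded_op_def by fastforce
next
  case False
  define p where "p = pnorm \<tau> U"
  have p: "p > 0"
    using False pnorm_nonneg[OF assms(1), of U] by (simp add: p_def)
  define V where "V = pscale (1 / p) U"
  have V: "V \<in> ell1e \<tau>" "pnorm \<tau> V = 1"
    using ell1e_pscale[OF assms(3), of "1 / p"] p by (auto simp: V_def p_def)
  have "U = pscale p V"
    using p by (intro pair_seq_eqI) (simp_all add: V_def pscale_entries)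
  then have "T U = pscale p (T V)"
    using assms(2) V(1) unfolding bounded_op_def linear_op_on_def by blast
  moreover have "T V \<in> ell1e \<tau>"
    using assms(2) V(1) unfolding bounded_op_def by blast
  ultimately have "pnorm \<tau> (T U) = p * pnorm \<tau> (T V)"
    using ell1e_pscale(2) p by auto
  moreover have "pnorm \<tau> (T V) \<le> opnorm \<tau> T"
    unfolding opnorm_def
    by (rule cSUP_upper[OF _ bounded_op_bdd_above[OF assms(1,2)]]) (use V in simp)
  ultimately show ?thesis
    using p by (simp add: p_def mult.commute)
qed

lemma opnorm_le:
  assumes "0 \<le> C" "\<And>U. U \<in> ell1e \<tau> \<Longrightarrow> pnorm \<tau> (T U) \<le> C * pnorm \<tau> U"
  shows "opnorm \<tau> T \<le> C"
  unfolding opnorm_def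
proof (rule cSUP_least)
  show "{U \<in> ell1e \<tau>. pnorm \<tau> U \<le> 1} \<noteq> {}"
    using ell1e_zero[of \<tau>] pnorm_zero[of \<tau>] by (metis (mono_tags, lifting) empty_Collect_eq zero_le_one)
  fix U assume "U \<in> {U \<in> ell1e \<tau>. pnorm \<tau> U \<le> 1}"
  then show "pnorm \<tau> (T U) \<le> C"
    using assms(2)[of U] mult_left_mono[of "pnorm \<tau> U" 1 C] assms(1) by auto
qed

lemma abs_entries_le_pnorm:
  assumes "1 \<le> \<tau>" "U \<in> ell1e \<tau>"
  shows "\<bar>fst U n\<bar> \<le> pnorm \<tau> U" "\<bar>snd U n\<bar> \<le> pnorm \<tau> U"
  using abs_le_norm1[OF assms(1), of "fst U" n] abs_le_norm1[OF assms(1), of "snd U" n]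
    norm1_nonneg[of \<tau> "fst U"] norm1_nonneg[of \<tau> "snd U"] assms
  by (auto simp: ell1e_iff pnorm_def)

text \<open>Such an operator is determined by its values on finitely many unit vectors, and each coordinate of
  \<open>U\<close> is at most its norm; so the sum of the norms of these values is a bound.\<close>

lemma finitely_many_modes_bounded_op:
  assumes \<tau>: "1 \<le> \<tau>" and lin: "linear_op_on (ell1e \<tau>) T"
    and range: "\<And>U. U \<in> ell1e \<tau> \<Longrightarrow> T U \<in> ell1e \<tau>"
    and modes: "\<And>U. U \<in> ell1e \<tau> \<Longrightarrow> T U = T (pproj_le M U)"
  shows "bounded_op \<tau> T"
proof -
  have \<tau>0: "0 \<le> \<tau>" using \<tau> by simp
  define unit :: "nat \<Rightarrow> seq" where "unit m = (\<lambda>n. if n = m then 1 else 0)" for m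
  have unit: "unit m \<in> ell1 \<tau>" for m
    by (rule finite_support_in_ell1[where M = m]) (simp add: unit_def)
  define c where "c m = pnorm \<tau> (T (unit m, 0)) + pnorm \<tau> (T (0, unit m))" for m
  have T_add: "T (U + V) = T U + T V" if "U \<in> ell1e \<tau>" "V \<in> ell1e \<tau>" for U V
    using lin that unfolding linear_op_on_def by blast
  have T_scale: "T (pscale a U) = pscale a (T U)" if "U \<in> ell1e \<tau>" for a U
    using lin that unfolding linear_op_on_def by blast
  have c_nonneg: "0 \<le> c m" for m
    using \<tau> by (simp add: c_def pnorm_nonneg)
  have finite: "pnorm \<tau> (T U) \<le> (\<Sum>m<K. c m) * pnorm \<tau> U"
    if "U \<in> ell1e \<tau>" "\<And>n. n \<ge> K \<Longrightarrow> fst U n = 0 \<and> snd U n = 0" for K U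
    using that
  proof (induction K arbitrary: U)
    case 0
    then have "U = 0"
      by (intro pair_seq_eqI) auto
    then show ?case
      by (simp add: linear_op_on_zero[OF lin])
  next
    case (Suc K)
    let ?p = "pnorm \<tau> U"
    define V where "V = (\<lambda>n. if n < K then fst U n else 0, \<lambda>n. if n < K then snd U n else 0)"
    define E where "E = pscale (fst U K) (unit K, 0)"
    define E' where "E' = pscale (snd U K) (0, unit K)"
    have V: "V \<in> ell1e \<tau>" "pnorm \<tau> V \<le> ?p"
      using ell1e_pointwise_bound[OF \<tau>0 Suc.prems(1), of V 1] by (auto simp: V_def)
    have basis: "(unit K, 0) \<in> ell1e \<tau>" "(0, unit K) \<in> ell1e \<tau>"
      using unit by (auto simp: ell1e_iff)
    have E: "E \<in> ell1e \<tau>" "E' \<in> ell1e \<tau>"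
      using basis by (simp_all add: E_def E'_def ell1e_pscale)
    have "U = V + E + E'"
    proof (rule pair_seq_eqI)
      fix n
      have "n < K \<or> n = K \<or> Suc K \<le> n" by auto
      then show "fst U n = fst (V + E + E') n" "snd U n = snd (V + E + E') n"
        using Suc.prems(2)[of n] by (auto simp: V_def E_def E'_def pscale_entries unit_def)
    qed
    then have TU: "T U = T V + T E + T E'"
      using T_add V(1) E ell1e_add(1)[OF \<tau>0] by simp
    have *: "pnorm \<tau> (T E) \<le> ?p * pnorm \<tau> (T (unit K, 0))" "pnorm \<tau> (T E') \<le> ?p * pnorm \<tau> (T (0, unit K))"
      using abs_entries_le_pnorm[OF \<tau> Suc.prems(1), of K] basis pnorm_nonneg[OF \<tau>0]
      by (auto simp: E_def E'_def T_scale ell1e_pscale(2) range pnorm_nonneg[OF \<tau>0] intro!: mult_right_mono)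
    have "pnorm \<tau> (T V) \<le> (\<Sum>m<K. c m) * pnorm \<tau> V"
      by (rule Suc.IH[OF V(1)]) (simp add: V_def)
    also have "\<dots> \<le> (\<Sum>m<K. c m) * ?p"
      using V(2) c_nonneg by (intro mult_left_mono sum_nonneg) auto
    finally have "pnorm \<tau> (T V) \<le> (\<Sum>m<K. c m) * ?p" .
    moreover have "pnorm \<tau> (T U) \<le> pnorm \<tau> (T V) + pnorm \<tau> (T E) + pnorm \<tau> (T E')"
      using ell1e_add(2)[OF \<tau>0 ell1e_add(1)[OF \<tau>0 range[OF V(1)] range[OF E(1)]] range[OF E(2)]]
        ell1e_add(2)[OF \<tau>0 range[OF V(1)] range[OF E(1)]]
      unfolding TU by linarith
    ultimately show ?case
      using * by (simp add: c_def algebra_simps)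
  qed
  have "pnorm \<tau> (T U) \<le> (\<Sum>m<Suc M. c m) * pnorm \<tau> U" if U: "U \<in> ell1e \<tau>" for U
  proof -
    have "pnorm \<tau> (T U) \<le> (\<Sum>m<Suc M. c m) * pnorm \<tau> (pproj_le M U)"
      unfolding modes[OF U] by (rule finite) (auto simp: pproj_le_entries)
    also have "pnorm \<tau> (pproj_le M U) \<le> pnorm \<tau> U"
      using ell1e_pointwise_bound(2)[OF \<tau>0 U, of "pproj_le M U" 1] by (simp add: pproj_le_entries)
    finally show ?thesis
      using c_nonneg by (simp add: mult_left_mono sum_nonneg)
  qed
  then show ?thesis
    using lin range unfolding bounded_op_def by blast
qed

section \<open>Norm bounds for the approximate inverse and the convolution operators\<close>

lemma freq2_nonneg: "0 \<le> freq2 d n"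
  by (simp add: freq2_def)

text \<open>The three terms are at most \<open>1\<close>, \<open>\<bar>\<nu>3 * \<nu> - 1\<bar> / \<nu>3\<close> and \<open>1 / \<nu>3\<close>, so the supremum is taken
  over a bounded set.\<close>

lemma Linf_upper:
  assumes "\<nu> > 0" "\<nu>3 > 0" "N < n"
  shows "1 / (\<nu> * freq2 d n + 1) + \<bar>\<nu>3 * \<nu> - 1\<bar> / ((\<nu> * freq2 d n + 1) * (freq2 d n + \<nu>3))
        + 1 / (freq2 d n + \<nu>3) \<le> Linf d \<nu> \<nu>3 N"
  unfolding Linf_def
proof (rule cSUP_upper)
  show "n \<in> {N<..}" using assms(3) by simp
  show "bdd_above ((\<lambda>n. 1 / (\<nu> * freq2 d n + 1) + \<bar>\<nu>3 * \<nu> - 1\<bar> / ((\<nu> * freq2 d n + 1) * (freq2 d n + \<nu>3))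
        + 1 / (freq2 d n + \<nu>3)) ` {N<..})"
  proof (rule bdd_aboveI2)
    fix n
    have a: "1 \<le> \<nu> * freq2 d n + 1" and b: "\<nu>3 \<le> freq2 d n + \<nu>3"
      using assms freq2_nonneg[of d n] by auto
    have "1 * \<nu>3 \<le> (\<nu> * freq2 d n + 1) * (freq2 d n + \<nu>3)"
      using a b assms by (intro mult_mono) auto
    then have "\<bar>\<nu>3 * \<nu> - 1\<bar> / ((\<nu> * freq2 d n + 1) * (freq2 d n + \<nu>3)) \<le> \<bar>\<nu>3 * \<nu> - 1\<bar> / \<nu>3"
      using assms by (intro divide_left_mono) auto
    moreover have "1 / (\<nu> * freq2 d n + 1) \<le> 1"
      using a by simp
    moreover have "1 / (freq2 d n + \<nu>3) \<le> 1 / \<nu>3"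
      using b assms by (intro divide_left_mono) auto
    ultimately show "1 / (\<nu> * freq2 d n + 1) + \<bar>\<nu>3 * \<nu> - 1\<bar> / ((\<nu> * freq2 d n + 1) * (freq2 d n + \<nu>3))
        + 1 / (freq2 d n + \<nu>3) \<le> 1 + \<bar>\<nu>3 * \<nu> - 1\<bar> / \<nu>3 + 1 / \<nu>3"
      by linarith
  qed
qed

lemma Linf_nonneg:
  assumes "\<nu> > 0" "\<nu>3 > 0"
  shows "0 \<le> Linf d \<nu> \<nu>3 N"
  by (rule order_trans[OF _ Linf_upper[OF assms lessI]])
    (use assms freq2_nonneg[of d "Suc N"] in \<open>auto intro!: add_nonneg_nonneg\<close>)

text \<open>On a mode beyond \<open>N\<close> the operator is a triangular matrix of size two, and the three summands in
  \<open>Linf\<close> are the absolute values of its entries; both column sums are at most their total.\<close>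

lemma Ap_tail_bound:
  assumes "0 \<le> \<tau>" "\<nu> > 0" "\<nu>3 > 0" "H \<in> ell1e \<tau>"
  shows "pproj_gt N (Ap d \<nu> \<nu>3 N AN H) \<in> ell1e \<tau>"
    and "pnorm \<tau> (pproj_gt N (Ap d \<nu> \<nu>3 N AN H)) \<le> Linf d \<nu> \<nu>3 N * pnorm \<tau> H"
proof -
  let ?X = "pproj_gt N (Ap d \<nu> \<nu>3 N AN H)"
  have le: "\<bar>fst ?X n\<bar> + \<bar>snd ?X n\<bar> \<le> Linf d \<nu> \<nu>3 N * (\<bar>fst H n\<bar> + \<bar>snd H n\<bar>)" for n
  proof (cases "n \<le> N")
    case True
    then show ?thesis
      using Linf_nonneg[OF assms(2,3)] by (simp add: pproj_gt_entries)
  next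
    case False
    let ?a = "\<nu> * freq2 d n + 1" and ?b = "freq2 d n + \<nu>3" and ?c = "\<nu>3 * \<nu> - 1"
    have ab: "?a > 0" "?b > 0"
      using assms freq2_nonneg[of d n] by (auto intro: add_nonneg_pos)
    have L: "1 / ?a + \<bar>?c\<bar> / (?a * ?b) + 1 / ?b \<le> Linf d \<nu> \<nu>3 N"
      using False by (intro Linf_upper assms) simp
    have "\<bar>fst ?X n\<bar> = (1 / ?a) * \<bar>fst H n\<bar>"
      using False ab by (simp add: pproj_gt_entries Ap_def abs_divide)
    moreover have "\<bar>snd ?X n\<bar> \<le> \<bar>?c\<bar> / (?a * ?b) * \<bar>fst H n\<bar> + (1 / ?b) * \<bar>snd H n\<bar>"
    proof -
      have "\<bar>snd ?X n\<bar> = \<bar>?c * fst H n / (?a * ?b) + snd H n / ?b\<bar>"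
        using False by (simp only: pproj_gt_entries Ap_def if_False snd_conv abs_minus_cancel)
      also have "\<dots> \<le> \<bar>?c * fst H n / (?a * ?b)\<bar> + \<bar>snd H n / ?b\<bar>"
        by (rule abs_triangle_ineq)
      also have "\<dots> = \<bar>?c\<bar> / (?a * ?b) * \<bar>fst H n\<bar> + (1 / ?b) * \<bar>snd H n\<bar>"
        using ab by (simp add: abs_divide abs_mult)
      finally show ?thesis .
    qed
    ultimately have "\<bar>fst ?X n\<bar> + \<bar>snd ?X n\<bar>
        \<le> (1 / ?a + \<bar>?c\<bar> / (?a * ?b)) * \<bar>fst H n\<bar> + (1 / ?b) * \<bar>snd H n\<bar>"
      by (simp add: distrib_right)
    also have "\<dots> \<le> Linf d \<nu> \<nu>3 N * \<bar>fst H n\<bar> + Linf d \<nu> \<nu>3 N * \<bar>snd H n\<bar>"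
    proof -
      have "0 \<le> 1 / ?a" "0 \<le> \<bar>?c\<bar> / (?a * ?b)" "0 \<le> 1 / ?b"
        using ab by auto
      with L have "1 / ?a + \<bar>?c\<bar> / (?a * ?b) \<le> Linf d \<nu> \<nu>3 N" "1 / ?b \<le> Linf d \<nu> \<nu>3 N"
        by linarith+
      then show ?thesis
        by (intro add_mono mult_right_mono) simp_all
    qed
    finally show ?thesis
      by (simp add: distrib_left)
  qed
  from ell1e_pointwise_bound[OF assms(1,4) le] Linf_nonneg[OF assms(2,3)]
  show "?X \<in> ell1e \<tau>" "pnorm \<tau> ?X \<le> Linf d \<nu> \<nu>3 N * pnorm \<tau> H"
    by auto
qed

lemma Ap_split:
  assumes "AN = pproj_le N \<circ> AN \<circ> pproj_le N"
  shows "Ap d \<nu> \<nu>3 N AN H = AN H + pproj_gt N (Ap d \<nu> \<nu>3 N AN H)"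
proof -
  have AN: "AN H = pproj_le N (AN (pproj_le N H))"
    using fun_cong[OF assms, of H] by simp
  show ?thesis
    unfolding AN
    by (rule pair_seq_eqI) (simp_all add: pproj_gt_entries pproj_le_entries Ap_def)
qed

lemma Ap_bound:
  assumes "0 \<le> \<tau>" "\<nu> > 0" "\<nu>3 > 0" "H \<in> ell1e \<tau>"
    and "AN = pproj_le N \<circ> AN \<circ> pproj_le N" "bounded_op \<tau> AN"
  shows "Ap d \<nu> \<nu>3 N AN H \<in> ell1e \<tau>"
    and "pnorm \<tau> (Ap d \<nu> \<nu>3 N AN H) \<le> (opnorm \<tau> AN + Linf d \<nu> \<nu>3 N) * pnorm \<tau> H"
proof -
  note tail = Ap_tail_bound[OF assms(1-4), where N = N and AN = AN and d = d]
  have AN: "AN H \<in> ell1e \<tau>"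
    using assms(4,6) unfolding bounded_op_def by blast
  note add = ell1e_add[OF assms(1) AN tail(1), folded Ap_split[OF assms(5)]]
  show "Ap d \<nu> \<nu>3 N AN H \<in> ell1e \<tau>"
    by (rule add(1))
  show "pnorm \<tau> (Ap d \<nu> \<nu>3 N AN H) \<le> (opnorm \<tau> AN + Linf d \<nu> \<nu>3 N) * pnorm \<tau> H"
    using add(2) tail(2) pnorm_le_opnorm[OF assms(1,6,4)] by (simp add: distrib_right)
qed

lemma DG_op_bound:
  assumes \<tau>: "1 \<le> \<tau>" and "X \<in> ell1 \<tau>" "Y \<in> ell1 \<tau>" "U \<in> ell1e \<tau>"
  shows "DG_op X Y U \<in> ell1e \<tau>"
    and "pnorm \<tau> (DG_op X Y U) \<le> (norm1 \<tau> X + norm1 \<tau> Y) * pnorm \<tau> U"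
proof -
  have \<tau>0: "0 \<le> \<tau>" using \<tau> by simp
  have U: "fst U \<in> ell1 \<tau>" "snd U \<in> ell1 \<tau>"
    using assms(4) by (simp_all add: ell1e_iff)
  note x = conv_in_ell1[OF \<tau> assms(2) U(1)] and y = conv_in_ell1[OF \<tau> assms(3) U(2)]
  show "DG_op X Y U \<in> ell1e \<tau>"
    using norm1_triangle(1)[OF \<tau>0 x(1) y(1)] by (simp add: DG_op_def ell1e_iff)
  have "pnorm \<tau> (DG_op X Y U) \<le> norm1 \<tau> X * norm1 \<tau> (fst U) + norm1 \<tau> Y * norm1 \<tau> (snd U)"
    using norm1_triangle(2)[OF \<tau>0 x(1) y(1)] x(2) y(2) by (simp add: DG_op_def pnorm_def)
  also have "\<dots> \<le> norm1 \<tau> X * pnorm \<tau> U + norm1 \<tau> Y * pnorm \<tau> U"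
    using norm1_nonneg[OF \<tau>0] by (intro add_mono mult_left_mono) (simp_all add: pnorm_def)
  finally show "pnorm \<tau> (DG_op X Y U) \<le> (norm1 \<tau> X + norm1 \<tau> Y) * pnorm \<tau> U"
    by (simp add: distrib_right)
qed

text \<open>If \<open>n \<le> N\<close> and \<open>\<bar>n - k\<bar> \<le> N\<close>, then \<open>\<bar>k\<bar> \<le> 2 * N\<close>. This is the source of the projection to
  modes at most \<open>2 N\<close> in the finite part of the bound.\<close>

lemma proj_le_conv_band:
  "proj_le N (proj_le N W \<star> U) = proj_le N (proj_le N W \<star> proj_le (2 * N) U)"
proof
  fix n
  have "(proj_le N W \<star> U) n = (proj_le N W \<star> proj_le (2 * N) U) n" if "n \<le> N"
  proof -
    have "zext (proj_le N W) (int n - k) * zext U k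
        = zext (proj_le N W) (int n - k) * zext (proj_le (2 * N) U) k" for k
      using that by (auto simp: zext_def proj_le_def)
    then show ?thesis
      unfolding conv_zext by presburger
  qed
  then show "proj_le N (proj_le N W \<star> U) n = proj_le N (proj_le N W \<star> proj_le (2 * N) U) n"
    by (simp add: proj_le_def)
qed

section \<open>Decomposition of the residual operator\<close>

lemma pproj_linear:
  "pproj_le N (X + Y) = pproj_le N X + pproj_le N Y"
  "pproj_le N (X - Y) = pproj_le N X - pproj_le N Y"
  "pproj_le N (pscale c X) = pscale c (pproj_le N X)"
  "pproj_gt N (X + Y) = pproj_gt N X + pproj_gt N Y"
  by (rule pair_seq_eqI; simp add: pproj_le_entries pproj_gt_entries pscale_entries)+

lemma pscale_distrib:
  "pscale c (X + Y) = pscale c X + pscale c Y"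
  "pscale c (X - Y) = pscale c X - pscale c Y"
  by (rule pair_seq_eqI; simp add: pscale_entries algebra_simps)+

lemma pproj_le_plus_gt: "pproj_le N X + pproj_gt N X = X"
  by (simp add: pproj_gt_def)

lemma Lp_linear:
  "Lp d \<nu> \<nu>3 (X + Y) = Lp d \<nu> \<nu>3 X + Lp d \<nu> \<nu>3 Y"
  "Lp d \<nu> \<nu>3 (pscale c X) = pscale c (Lp d \<nu> \<nu>3 X)"
  by (rule pair_seq_eqI; simp add: Lp_def pscale_entries algebra_simps)+

lemma Ap_linear:
  assumes "linear_op_on UNIV AN"
  shows "Ap d \<nu> \<nu>3 N AN (X + Y) = Ap d \<nu> \<nu>3 N AN X + Ap d \<nu> \<nu>3 N AN Y"
    and "Ap d \<nu> \<nu>3 N AN (pscale c X) = pscale c (Ap d \<nu> \<nu>3 N AN X)"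
proof -
  have add: "AN (U + V) = AN U + AN V" and scale: "AN (pscale c U) = pscale c (AN U)" for U V
    using assms unfolding linear_op_on_def by blast+
  show "Ap d \<nu> \<nu>3 N AN (X + Y) = Ap d \<nu> \<nu>3 N AN X + Ap d \<nu> \<nu>3 N AN Y"
    by (rule pair_seq_eqI) (simp_all add: Ap_def pproj_linear add add_divide_distrib distrib_left)
  show "Ap d \<nu> \<nu>3 N AN (pscale c X) = pscale c (Ap d \<nu> \<nu>3 N AN X)"
    by (rule pair_seq_eqI)
      (simp_all add: Ap_def pproj_linear scale pscale_entries distrib_left mult.left_commute right_diff_distrib)
qed

lemma DG_op_linear:
  assumes \<tau>: "1 \<le> \<tau>" and X: "X \<in> ell1 \<tau>" and Y: "Y \<in> ell1 \<tau>" and U: "U \<in> ell1e \<tau>" and V: "V \<in> ell1e \<tau>"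
  shows "DG_op X Y (U + V) = DG_op X Y U + DG_op X Y V"
    and "DG_op X Y (pscale c U) = pscale c (DG_op X Y U)"
  using U V conv_add_right[OF \<tau> X, of "fst U" "fst V"] conv_add_right[OF \<tau> Y, of "snd U" "snd V"]
  by (auto simp: DG_op_def ell1e_iff pscale_def conv_sscale_right)
    (auto simp: sscale_def fun_eq_iff distrib_left)

text \<open>Beyond mode \<open>N\<close> the operator \<open>Ap\<close> is the modewise inverse of \<open>Lp\<close>. This cancels the identity
  there and keeps the unbounded growth of \<open>Lp\<close> out of the residual.\<close>

lemma Ap_tail_Lp:
  assumes "\<nu> > 0" "\<nu>3 > 0"
  shows "pproj_gt N (Ap d \<nu> \<nu>3 N AN (Lp d \<nu> \<nu>3 U)) = pproj_gt N U"
proof (rule pair_seq_eqI)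
  fix n
  let ?a = "\<nu> * freq2 d n + 1" and ?b = "freq2 d n + \<nu>3" and ?c = "\<nu>3 * \<nu> - 1"
  have ab: "?a \<noteq> 0" "?b \<noteq> 0"
    using assms freq2_nonneg[of d n] by (smt (verit) mult_nonneg_nonneg)+
  have fst_eq: "- (- a * u / a) = u" if "a \<noteq> 0" for a u :: real
    using that by simp
  have snd_eq: "- (c * (- a * u) / (a * b) + (c * u - b * v) / b) = v"
    if "a \<noteq> 0" "b \<noteq> 0" for a b c u v :: real
    using that by (simp add: field_simps)
  show "fst (pproj_gt N (Ap d \<nu> \<nu>3 N AN (Lp d \<nu> \<nu>3 U))) n = fst (pproj_gt N U) n"
    using fst_eq[OF ab(1)]
    by (simp only: pproj_gt_entries Ap_def Lp_def fst_conv split: if_split) blast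
  show "snd (pproj_gt N (Ap d \<nu> \<nu>3 N AN (Lp d \<nu> \<nu>3 U))) n = snd (pproj_gt N U) n"
    using snd_eq[OF ab]
    by (simp only: pproj_gt_entries Ap_def Lp_def fst_conv snd_conv split: if_split) blast
qed

lemma pproj_le_Ap_cong:
  assumes "pproj_le N X = pproj_le N Y"
  shows "pproj_le N (Ap d \<nu> \<nu>3 N AN X) = pproj_le N (Ap d \<nu> \<nu>3 N AN Y)"
  by (rule pair_seq_eqI) (simp_all add: pproj_le_entries Ap_def assms)

text \<open>Modes at most \<open>N\<close> of \<open>A X\<close> depend only on modes at most \<open>N\<close> of \<open>X\<close>, and for
  \<open>X = Lp U + DGN U\<close> these depend only on modes at most \<open>2 N\<close> of \<open>U\<close>. Beyond \<open>N\<close>, the term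
  \<open>A (Lp U)\<close> cancels \<open>U\<close>.\<close>

lemma residual_decomposition:
  fixes d :: real and N :: nat and W1 W2 :: seq
  assumes \<tau>: "1 \<le> \<tau>" and pos: "\<nu> > 0" "\<nu>3 > 0" and AN: "linear_op_on UNIV AN"
    and V: "V1 \<in> ell1 \<tau>" "V2 \<in> ell1 \<tau>" and U: "U \<in> ell1e \<tau>"
  defines "A \<equiv> Ap d \<nu> \<nu>3 N AN"
    and "DGN \<equiv> DG_op (proj_le N W1) (proj_le N W2)"
    and "E \<equiv> DG_op (V1 - proj_le N W1) (V2 - proj_le N W2)"
  shows "U - A (Lp d \<nu> \<nu>3 U + DG_op V1 V2 U)
    = pproj_le N (pproj_le (2 * N) U - A (Lp d \<nu> \<nu>3 (pproj_le (2 * N) U) + DGN (pproj_le (2 * N) U)))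
      - pproj_gt N (A (DGN U)) - A (E U)"
proof -
  let ?P = "pproj_le (2 * N) U"
  note A_add = Ap_linear(1)[OF AN, where d = d and N = N and \<nu> = \<nu> and ?\<nu>3.0 = \<nu>3, folded A_def]
  have DG: "DG_op V1 V2 U = DGN U + E U"
    using U conv_diff_left[OF \<tau> _ V(1) proj_le_in_ell1, of "fst U" N W1]
      conv_diff_left[OF \<tau> _ V(2) proj_le_in_ell1, of "snd U" N W2]
    by (simp add: DG_op_def DGN_def E_def ell1e_iff)
  have low: "pproj_le N (Lp d \<nu> \<nu>3 U + DGN U) = pproj_le N (Lp d \<nu> \<nu>3 ?P + DGN ?P)"
  proof -
    have "pproj_le N (Lp d \<nu> \<nu>3 U) = pproj_le N (Lp d \<nu> \<nu>3 ?P)"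
      by (rule pair_seq_eqI) (simp_all add: pproj_le_entries Lp_def)
    moreover have "pproj_le N (DGN U) = pproj_le N (DGN ?P)"
    proof -
      have DG: "pproj_le N (DG_op X Y Z) = (proj_le N (X \<star> fst Z) + proj_le N (Y \<star> snd Z), 0)" for X Y Z
        by (rule pair_seq_eqI) (auto simp: pproj_le_entries DG_op_def proj_le_def)
      have P: "fst ?P = proj_le (2 * N) (fst U)" "snd ?P = proj_le (2 * N) (snd U)"
        by (simp_all add: pproj_le_def)
      show ?thesis
        unfolding DGN_def DG P
        by (simp only: proj_le_conv_band[of N W1 "fst U"] proj_le_conv_band[of N W2 "snd U"])
    qed
    ultimately show ?thesis by (simp add: pproj_linear)
  qed
  have PN: "pproj_le N ?P = pproj_le N U"
    by (rule pair_seq_eqI) (simp_all add: pproj_le_entries)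
  have "A (Lp d \<nu> \<nu>3 U + DGN U)
      = pproj_le N (A (Lp d \<nu> \<nu>3 U + DGN U)) + pproj_gt N (A (Lp d \<nu> \<nu>3 U + DGN U))"
    by (simp add: pproj_le_plus_gt)
  also have "pproj_le N (A (Lp d \<nu> \<nu>3 U + DGN U)) = pproj_le N (A (Lp d \<nu> \<nu>3 ?P + DGN ?P))"
    unfolding A_def by (rule pproj_le_Ap_cong[OF low])
  also have "pproj_gt N (A (Lp d \<nu> \<nu>3 U + DGN U)) = pproj_gt N U + pproj_gt N (A (DGN U))"
    unfolding A_add pproj_linear using Ap_tail_Lp[OF pos] by (simp add: A_def)
  finally have AU: "A (Lp d \<nu> \<nu>3 U + DG_op V1 V2 U)
      = pproj_le N (A (Lp d \<nu> \<nu>3 ?P + DGN ?P)) + (pproj_gt N U + pproj_gt N (A (DGN U))) + A (E U)"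
    unfolding DG by (simp add: A_add flip: add.assoc)
  have B: "pproj_le N (?P - A (Lp d \<nu> \<nu>3 ?P + DGN ?P))
      = pproj_le N U - pproj_le N (A (Lp d \<nu> \<nu>3 ?P + DGN ?P))"
    by (simp add: pproj_linear PN)
  have "p + g - (a + (g + t) + e) = p - a - t - e" for p g a t e :: "seq \<times> seq"
    by (simp add: algebra_simps)
  from this[of "pproj_le N U" "pproj_gt N U"] show ?thesis
    unfolding AU B pproj_le_plus_gt .
qed

lemma finite_block_bounded:
  assumes "1 \<le> \<tau>" "linear_op_on UNIV AN" and band: "AN = pproj_le N \<circ> AN \<circ> pproj_le N"
  shows "bounded_op \<tau> AN"
proof (rule finitely_many_modes_bounded_op[OF assms(1)])
  show "linear_op_on (ell1e \<tau>) AN"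
    using assms(2) unfolding linear_op_on_def by blast
  have AN_eq: "AN U = pproj_le N (AN (pproj_le N U))" for U
    using fun_cong[OF band, of U] by simp
  show "AN U \<in> ell1e \<tau>" for U
    by (subst AN_eq) simp
  have idem: "pproj_le N (pproj_le N U) = pproj_le N U" for U
    by (rule pair_seq_eqI) (simp_all add: pproj_le_entries)
  show "AN U = AN (pproj_le N U)" for U
    using AN_eq[of U] AN_eq[of "pproj_le N U"] unfolding idem by (rule trans[OF _ sym])
qed

text \<open>Boundedness has to be obtained from the decomposition: \<open>Lp U\<close> need not lie in \<open>ell1e \<tau>\<close>, so the
  residual is not visibly a composition of bounded operators.\<close>

lemma residual_bounded:
  fixes d :: real and N :: nat and W1 W2 :: seq
  assumes \<tau>: "1 \<le> \<tau>" and pos: "\<nu> > 0" "\<nu>3 > 0" and AN: "linear_op_on UNIV AN"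
    and AN_band: "AN = pproj_le N \<circ> AN \<circ> pproj_le N"
    and V: "V1 \<in> ell1 \<tau>" "V2 \<in> ell1 \<tau>"
  defines "A \<equiv> Ap d \<nu> \<nu>3 N AN"
    and "DGN \<equiv> DG_op (proj_le N W1) (proj_le N W2)"
    and "T \<equiv> \<lambda>U. U - Ap d \<nu> \<nu>3 N AN (Lp d \<nu> \<nu>3 U + DG_op V1 V2 U)"
  shows "bounded_op \<tau> T"
    and "opnorm \<tau> T \<le>
      opnorm \<tau> (\<lambda>U. pproj_le N (pproj_le (2 * N) U
        - A (Lp d \<nu> \<nu>3 (pproj_le (2 * N) U) + DGN (pproj_le (2 * N) U))))
      + Linf d \<nu> \<nu>3 N * (norm1 \<tau> (proj_le N W1) + norm1 \<tau> (proj_le N W2))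
      + (opnorm \<tau> AN + Linf d \<nu> \<nu>3 N) * (norm1 \<tau> (V1 - proj_le N W1) + norm1 \<tau> (V2 - proj_le N W2))"
    (is "_ \<le> opnorm \<tau> ?B + ?t + ?e")
proof -
  have \<tau>0: "0 \<le> \<tau>" using \<tau> by simp
  let ?E = "DG_op (V1 - proj_le N W1) (V2 - proj_le N W2)"
  note A_lin = Ap_linear[OF AN, where d = d and N = N and \<nu> = \<nu> and ?\<nu>3.0 = \<nu>3, folded A_def]
  note bounded_AN = finite_block_bounded[OF \<tau> AN AN_band]
  have bounded_B: "bounded_op \<tau> ?B"
  proof (rule finitely_many_modes_bounded_op[OF \<tau>, where M = "2 * N"])
    note DG_lin = DG_op_linear[OF \<tau> proj_le_in_ell1 proj_le_in_ell1 pproj_le_in_ell1e pproj_le_in_ell1e]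
    show "linear_op_on (ell1e \<tau>) ?B"
      unfolding linear_op_on_def DGN_def
      by (auto simp: pproj_linear Lp_linear A_lin DG_lin pscale_distrib algebra_simps simp flip: pscale_distrib(1))
    have idem: "pproj_le (2 * N) (pproj_le (2 * N) U) = pproj_le (2 * N) U" for U
      by (rule pair_seq_eqI) (simp_all add: pproj_le_entries)
    show "?B U = ?B (pproj_le (2 * N) U)" for U
      by (simp add: idem)
  qed simp
  have mem: "T U \<in> ell1e \<tau>" and le: "pnorm \<tau> (T U) \<le> (opnorm \<tau> ?B + ?t + ?e) * pnorm \<tau> U"
    if U: "U \<in> ell1e \<tau>" for U
  proof -
    have B: "?B U \<in> ell1e \<tau>" by simp
    note G = DG_op_bound[OF \<tau> proj_le_in_ell1[of N W1] proj_le_in_ell1[of N W2] U, folded DGN_def]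
    note E = DG_op_bound[OF \<tau> ell1_diff(1)[OF \<tau>0 V(1) proj_le_in_ell1[of N W1]]
        ell1_diff(1)[OF \<tau>0 V(2) proj_le_in_ell1[of N W2]] U]
    note AG = Ap_tail_bound[OF \<tau>0 pos G(1), where d = d and N = N and AN = AN, folded A_def]
    note AE = Ap_bound[OF \<tau>0 pos E(1) AN_band bounded_AN, where d = d, folded A_def]
    have eq: "T U = ?B U - pproj_gt N (A (DGN U)) - A (?E U)"
      unfolding T_def A_def DGN_def by (rule residual_decomposition[OF \<tau> pos AN V U])
    note BG = ell1e_diff[OF \<tau>0 B AG(1)]
    note all = ell1e_diff[OF \<tau>0 BG(1) AE(1), folded eq]
    show "T U \<in> ell1e \<tau>" by (rule all(1))
    have "pnorm \<tau> (pproj_gt N (A (DGN U))) \<le> ?t * pnorm \<tau> U"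
      using order_trans[OF AG(2) mult_left_mono[OF G(2) Linf_nonneg[OF pos]]] by (simp add: mult.assoc)
    moreover have "0 \<le> opnorm \<tau> AN + Linf d \<nu> \<nu>3 N"
      using opnorm_nonneg[OF \<tau>0 bounded_AN] Linf_nonneg[OF pos] by simp
    then have "pnorm \<tau> (A (?E U)) \<le> ?e * pnorm \<tau> U"
      using order_trans[OF AE(2) mult_left_mono[OF E(2)]] by (simp add: mult.assoc)
    moreover have "pnorm \<tau> (?B U) \<le> opnorm \<tau> ?B * pnorm \<tau> U"
      by (rule pnorm_le_opnorm[OF \<tau>0 bounded_B U])
    ultimately show "pnorm \<tau> (T U) \<le> (opnorm \<tau> ?B + ?t + ?e) * pnorm \<tau> U"
      using BG(2) all(2) unfolding distrib_right by linarith
  qed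
  have "linear_op_on (ell1e \<tau>) T"
    unfolding linear_op_on_def T_def
    by (auto simp: Lp_linear A_lin[unfolded A_def] DG_op_linear[OF \<tau> V] pscale_distrib algebra_simps
        simp flip: pscale_distrib(1))
  then show "bounded_op \<tau> T"
    unfolding bounded_op_def using mem le by blast
  show "opnorm \<tau> T \<le> opnorm \<tau> ?B + ?t + ?e"
  proof (rule opnorm_le[OF _ le])
    show "0 \<le> opnorm \<tau> ?B + ?t + ?e"
      using opnorm_nonneg[OF \<tau>0 bounded_B] opnorm_nonneg[OF \<tau>0 bounded_AN] Linf_nonneg[OF pos]
        norm1_nonneg[OF \<tau>0]
      by (intro add_nonneg_nonneg mult_nonneg_nonneg) auto
  qed
qed

theorem lemma3p6:
  fixes \<nu> \<nu>1 \<nu>2 \<nu>3 \<nu>4 \<nu>5 \<tau> d :: real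
    and N N0 :: nat
    and U1 U2 \<Phi> \<Phi>inv \<Psi>1 \<Psi>2 V1 V2 W1 W2 V1N V2N :: seq
    and AN DG DGN DF A :: "seq \<times> seq \<Rightarrow> seq \<times> seq"
    and Zinf1 Zinf2 Zinf Z1 :: real
  assumes "\<nu> > 0" "\<nu>1 > 0" "\<nu>2 > 0" "\<nu>3 > 0" "\<nu>4 > 0" "\<nu>5 > 0" "\<nu>2 > 1 / 4" "\<tau> \<ge> 1" "d \<ge> 1"
    and "(U1, U2) = pproj_le N0 (U1, U2)"
    and "\<Phi> = e0 + U1 + \<nu>2 \<cdot> (U1 \<star> U1)"
    and "\<Psi>1 = - \<nu>1 \<cdot> (- U2 + (2 * \<nu>) \<cdot> U1 + \<nu> \<cdot> (U1 \<star> U1) + \<nu>2 \<cdot> (U1 \<star> U1 \<star> U2))"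
    and "\<Psi>2 = \<nu>1 \<cdot> U1"
    and "\<Phi>inv = proj_le (2 * N0) \<Phi>inv"
    and "V1 = \<Psi>1 \<star> (conv_inv \<tau> \<Phi> \<star> conv_inv \<tau> \<Phi>)"
    and "V2 = \<Psi>2 \<star> conv_inv \<tau> \<Phi>"
    and "W1 = \<Psi>1 \<star> (\<Phi>inv \<star> \<Phi>inv)"
    and "W2 = \<Psi>2 \<star> \<Phi>inv"
    and "V1N = proj_le N W1"
    and "V2N = proj_le N W2"
    and "DG = DG_op V1 V2"
    and "DGN = DG_op V1N V2N"
    and "DF = (\<lambda>U. Lp d \<nu> \<nu>3 U + DG U)"
    and "linear_op_on UNIV AN"
    and "AN = pproj_le N \<circ> AN \<circ> pproj_le N"
    and "A = Ap d \<nu> \<nu>3 N AN"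
    and "norm1 \<tau> (e0 - \<Phi> \<star> \<Phi>inv) < 1"
    and "norm1 \<tau> (e0 - (\<Phi> \<star> \<Phi>) \<star> (\<Phi>inv \<star> \<Phi>inv)) < 1"
    and "Zinf1 = norm1 \<tau> (V1N - W1)
           + norm1 \<tau> (\<Psi>1 \<star> (\<Phi>inv \<star> \<Phi>inv) \<star> (e0 - (\<Phi> \<star> \<Phi>) \<star> (\<Phi>inv \<star> \<Phi>inv)))
             / (1 - norm1 \<tau> (e0 - (\<Phi> \<star> \<Phi>) \<star> (\<Phi>inv \<star> \<Phi>inv)))"
    and "Zinf2 = norm1 \<tau> (V2N - W2)
           + norm1 \<tau> (\<Psi>2 \<star> \<Phi>inv \<star> (e0 - \<Phi> \<star> \<Phi>inv))
             / (1 - norm1 \<tau> (e0 - \<Phi> \<star> \<Phi>inv))"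
    and "Zinf = (opnorm \<tau> AN + Linf d \<nu> \<nu>3 N) * (Zinf1 + Zinf2)"
    and "Z1 = opnorm \<tau> (\<lambda>U. pproj_le N (pproj_le (2 * N) U
                 - A (Lp d \<nu> \<nu>3 (pproj_le (2 * N) U) + DGN (pproj_le (2 * N) U))))
           + 2 * Linf d \<nu> \<nu>3 N * (norm1 \<tau> V1N + norm1 \<tau> V2N) + Zinf"
  shows "bounded_op \<tau> (\<lambda>U. U - A (DF U)) \<and> opnorm \<tau> (\<lambda>U. U - A (DF U)) \<le> Z1"
proof -
  note def_eqs = assms(11-23)
  have \<tau>: "1 \<le> \<tau>" and \<tau>0: "0 \<le> \<tau>" and pos: "\<nu> > 0" "\<nu>3 > 0"
    using assms(1,4,8) by auto
  note conv = conv_in_ell1(1)[OF \<tau>] and add = norm1_triangle(1)[OF \<tau>0] and scale = sscale_in_ell1(1)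
  have "U1 = proj_le N0 U1" "U2 = proj_le N0 U2"
    using assms(10) by (simp_all add: pproj_le_def)
  then have U: "U1 \<in> ell1 \<tau>" "U2 \<in> ell1 \<tau>"
    by (metis proj_le_in_ell1)+
  have P: "\<Phi>inv \<in> ell1 \<tau>"
    using assms(14) by (metis proj_le_in_ell1)
  have \<Phi>: "\<Phi> \<in> ell1 \<tau>"
    unfolding def_eqs(1) by (intro add scale conv e0_in_ell1 U)
  have \<Psi>: "\<Psi>1 \<in> ell1 \<tau>" "\<Psi>2 \<in> ell1 \<tau>"
    unfolding def_eqs(2,3) by (intro add scale conv ell1_minus[THEN iffD2] U)+
  define I where "I = conv_inv \<tau> \<Phi>"
  have I: "I \<in> ell1 \<tau>" "\<Phi> \<star> I = e0"
    using approximately_invertible[OF \<tau> \<Phi> P assms(27)] by (simp_all add: I_def)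
  have V: "V1 \<in> ell1 \<tau>" "V2 \<in> ell1 \<tau>"
    using conv \<Psi> I(1) by (simp_all add: assms(15,16) I_def)
  have W: "W1 \<in> ell1 \<tau>" "W2 \<in> ell1 \<tau>"
    using conv \<Psi> P by (simp_all add: assms(17,18))
  \<comment> \<open>The truncation error splits at the computable product \<open>W\<close> into a discarded tail and an inversion error.\<close>
  have diff: "norm1 \<tau> (V - VN) \<le> norm1 \<tau> (VN - W) + norm1 \<tau> (V - W)"
    if "V \<in> ell1 \<tau>" "VN \<in> ell1 \<tau>" "W \<in> ell1 \<tau>" for V VN W
  proof -
    have "V - VN = (V - W) + (W - VN)" by simp
    then show ?thesis
      using norm1_triangle(2)[OF \<tau>0, of "V - W" "W - VN"] that ell1_diff(1)[OF \<tau>0]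
      by (metis add.commute norm1_minus_commute)
  qed
  have "norm1 \<tau> (V1 - W1) \<le> norm1 \<tau> (\<Psi>1 \<star> (\<Phi>inv \<star> \<Phi>inv) \<star> (e0 - (\<Phi> \<star> \<Phi>) \<star> (\<Phi>inv \<star> \<Phi>inv)))
             / (1 - norm1 \<tau> (e0 - (\<Phi> \<star> \<Phi>) \<star> (\<Phi>inv \<star> \<Phi>inv)))"
    unfolding assms(15,17) I_def[symmetric]
    by (rule approximate_inverse_error[OF \<tau> conv[OF \<Phi> \<Phi>] conv[OF P P] conv[OF I(1) I(1)] \<Psi>(1)
        conv_square_inverse[OF \<tau> \<Phi> I] assms(28)])
  then have Z1': "norm1 \<tau> (V1 - proj_le N W1) \<le> Zinf1"
    using diff[OF V(1) proj_le_in_ell1 W(1)] unfolding assms(29,19) by (meson add_left_mono order_trans)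
  have "norm1 \<tau> (V2 - W2) \<le> norm1 \<tau> (\<Psi>2 \<star> \<Phi>inv \<star> (e0 - \<Phi> \<star> \<Phi>inv)) / (1 - norm1 \<tau> (e0 - \<Phi> \<star> \<Phi>inv))"
    unfolding assms(16,18) I_def[symmetric]
    by (rule approximate_inverse_error[OF \<tau> \<Phi> P I(1) \<Psi>(2) I(2) assms(27)])
  then have Z2': "norm1 \<tau> (V2 - proj_le N W2) \<le> Zinf2"
    using diff[OF V(2) proj_le_in_ell1 W(2)] unfolding assms(30,20) by (meson add_left_mono order_trans)
  define B where "B = opnorm \<tau> (\<lambda>U. pproj_le N (pproj_le (2 * N) U
                 - A (Lp d \<nu> \<nu>3 (pproj_le (2 * N) U) + DGN (pproj_le (2 * N) U))))"
  define L where "L = Linf d \<nu> \<nu>3 N"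
  define M where "M = norm1 \<tau> (proj_le N W1) + norm1 \<tau> (proj_le N W2)"
  define D where "D = norm1 \<tau> (V1 - proj_le N W1) + norm1 \<tau> (V2 - proj_le N W2)"
  have T: "(\<lambda>U. U - A (DF U)) = (\<lambda>U. U - Ap d \<nu> \<nu>3 N AN (Lp d \<nu> \<nu>3 U + DG_op V1 V2 U))"
    by (simp only: assms(21,23,26))
  have "opnorm \<tau> (\<lambda>U. U - A (DF U)) \<le> B + L * M + (opnorm \<tau> AN + L) * D"
    unfolding B_def L_def M_def D_def assms(19-23,26) by (rule residual_bounded(2)[OF \<tau> pos assms(24,25) V])
  moreover have "0 \<le> L" "0 \<le> M" "0 \<le> opnorm \<tau> AN"
    using Linf_nonneg[OF pos] norm1_nonneg[OF \<tau>0] opnorm_nonneg[OF \<tau>0 finite_block_bounded[OF \<tau> assms(24,25)]]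
    by (simp_all add: L_def M_def)
  then have "L * M \<le> 2 * L * M" "(opnorm \<tau> AN + L) * D \<le> (opnorm \<tau> AN + L) * (Zinf1 + Zinf2)"
    using Z1' Z2' by (auto simp: D_def intro!: mult_left_mono)
  moreover have "Z1 = B + 2 * L * M + (opnorm \<tau> AN + L) * (Zinf1 + Zinf2)"
    unfolding assms(31,32) B_def L_def M_def by (simp only: assms(19,20))
  ultimately have "opnorm \<tau> (\<lambda>U. U - A (DF U)) \<le> Z1"
    by linarith
  moreover have "bounded_op \<tau> (\<lambda>U. U - A (DF U))"
    unfolding T by (rule residual_bounded(1)[OF \<tau> pos assms(24,25) V])
  ultimately show ?thesis
    by blast
qed

end
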